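(* There exists a real, even, transcendental entire map $f\colon\mathbb{C}\to\mathbb{C}$ such that: (1) $f\colon\mathbb{R}\to\mathbb{R}$ is convex; (2) $f(\mathbb{Q})\subset\mathbb{Q}$; (3) the periodic points of $f\colon f^{-1}(\mathbb{D})\cap\mathbb{D}\to\mathbb{D}$ and of $f\colon\mathbb{R}\to\mathbb{R}$ coincide and all lie in $\mathbb{Q}$, and the multipliers of $f$ at these periodic points all lie in $\mathbb{Q}$; (4) $f\colon f^{-1}(\mathbb{D})\cap\mathbb{D}\to\mathbb{D}$ is an escaping quadratic-like map that is not conjugate to an affine escaping quadratic-like map.
   Context: $\mathbb{D}$ is the open unit disk. An entire map is real if $f(\bar z)=\overline{f(z)}$ and even if $f(-z)=f(z)$. For a map $f\colon U\to V$ with $U\subseteq V$, a periodic point is a point $z\in U$ with $f^{\circ n}(z)=z$ for some $n\ge1$ and $z,f(z),\dots,f^{\circ(n-1)}(z)\in U$; the multiplier at such a point (of exact period $n$) is $(f^{\circ n})'(z)$. An escaping quadratic-like map is a holomorphic covering map $f\colon U\to V$ of degree $2$, where $U,V$ are nonempty open subsets of $\mathbb{C}$ with $U$ relatively compact in $V$ and $V$ simply connected (then $U$ has two connected components each mapped biholomorphically onto $V$). Such an $f$ is conjugate to an affine escaping quadratic-like map if there is a univalent map $\varphi\colon V\to\mathbb{C}$ such that $\varphi\circ f\circ\varphi^{-1}$ is affine on each of the two connected components of $\varphi(U)$. *)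

theory Defs
  imports "HOL-Complex_Analysis.Complex_Analysis" "HOL-Computational_Algebra.Polynomial"
begin

definition real_map :: "(complex \<Rightarrow> complex) \<Rightarrow> bool" where
  "real_map f \<longleftrightarrow> (\<forall>z. f (cnj z) = cnj (f z))"

definition even_map :: "(complex \<Rightarrow> complex) \<Rightarrow> bool" where
  "even_map f \<longleftrightarrow> (\<forall>z. f (- z) = f z)"

definition transcendental_entire :: "(complex \<Rightarrow> complex) \<Rightarrow> bool" where
  "transcendental_entire f \<longleftrightarrow> f holomorphic_on UNIV \<and> \<not> (\<exists>p :: complex poly. \<forall>z. f z = poly p z)"

definition periodic_point :: "(complex \<Rightarrow> complex) \<Rightarrow> complex set \<Rightarrow> complex \<Rightarrow> bool" where
  "periodic_point f U z \<longleftrightarrow> (\<exists>n\<ge>1. (f ^^ n) z = z \<and> (\<forall>k<n. (f ^^ k) z \<in> U))"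

definition exact_period :: "(complex \<Rightarrow> complex) \<Rightarrow> complex \<Rightarrow> nat \<Rightarrow> bool" where
  "exact_period f z n \<longleftrightarrow> n \<ge> 1 \<and> (f ^^ n) z = z \<and> (\<forall>m. 1 \<le> m \<and> m < n \<longrightarrow> (f ^^ m) z \<noteq> z)"

definition multiplier :: "(complex \<Rightarrow> complex) \<Rightarrow> complex \<Rightarrow> nat \<Rightarrow> complex" where
  "multiplier f z n = deriv (f ^^ n) z"

definition escaping_quadratic_like :: "(complex \<Rightarrow> complex) \<Rightarrow> complex set \<Rightarrow> complex set \<Rightarrow> bool" where
  "escaping_quadratic_like f U V \<longleftrightarrow>
     U \<noteq> {} \<and> V \<noteq> {} \<and> open U \<and> open V \<and>
     compact (closure U) \<and> closure U \<subseteq> V \<and> simply_connected V \<and>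
     f holomorphic_on U \<and> covering_space U f V \<and>
     (\<forall>w\<in>V. card {z\<in>U. f z = w} = 2)"

definition conj_affine_eql :: "(complex \<Rightarrow> complex) \<Rightarrow> complex set \<Rightarrow> complex set \<Rightarrow> bool" where
  "conj_affine_eql f U V \<longleftrightarrow>
     (\<exists>\<phi>. \<phi> holomorphic_on V \<and> inj_on \<phi> V \<and>
        (\<forall>C\<in>components (\<phi> ` U). \<exists>a b. \<forall>w\<in>C. \<phi> (f (inv_into V \<phi> w)) = a * w + b))"

end

theory Submission
  imports Defs
begin

text \<open>
  The map is a limit of polynomials \<open>p\<^sub>n(z\<^sup>2)\<close> with rational coefficients, starting from \<open>4 z\<^sup>2 - 2\<close>
  and staying within \<open>1/100\<close> of it on the disc of radius 2. This closeness alone makes the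
  restriction to the unit disc an escaping quadratic-like map with two expanding inverse branches, so
  that periodic points are real and determined by their itineraries; it also keeps the multiplier of
  the 2-cycle away from the product of the multipliers of the fixed points, which rules out
  an affine model.

  Step \<open>n\<close> moves all points of period \<open>n + 1\<close> to rational positions by a small interpolating
  polynomial, and then freezes value and derivative there, and the value at the \<open>n\<close>-th rational
  number, by making all later corrections divisible by \<open>\<Prod>(w - s\<^sup>2)\<^sup>2\<close>, where \<open>w = z\<^sup>2\<close>.
  Convexity persists because all coefficients of \<open>p\<^sub>n\<close> of positive index up to a bound \<open>d\<close> are positive:
  a correction of degree at most \<open>d\<close> with small coefficients preserves this, and \<open>d\<close> is raised beforehand
  by adding small multiples of \<open>w\<^sup>k - (w\<^sup>k mod D)\<close>, where \<open>D\<close> is the frozen product. The coefficients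
  stay bounded below, so the limit is not a polynomial.
\<close>

section \<open>Even polynomials with rational coefficients\<close>

abbreviation eval_rat :: "rat poly \<Rightarrow> 'a::field_char_0 \<Rightarrow> 'a" where
  "eval_rat p \<equiv> poly (map_poly of_rat p)"

lemma eval_rat_pCons: "eval_rat (pCons a p) x = of_rat a + x * eval_rat p x"
  by (simp add: map_poly_pCons)

lemma eval_rat_add: "eval_rat (p + q) x = eval_rat p x + eval_rat q x"
proof -
  have "map_poly of_rat (p + q) = map_poly of_rat p + (map_poly of_rat q :: 'a poly)"
    by (rule poly_eqI) (simp add: coeff_map_poly of_rat_add)
  then show ?thesis by simp
qed

lemma eval_rat_smult: "eval_rat (smult c p) x = of_rat c * eval_rat p x"
  by (induction p) (auto simp: eval_rat_pCons of_rat_mult algebra_simps)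

lemma eval_rat_mult: "eval_rat (p * q) x = eval_rat p x * eval_rat q x"
  by (induction p) (auto simp: eval_rat_pCons eval_rat_add eval_rat_smult algebra_simps)

lemma eval_rat_of_rat: "eval_rat p (of_rat r) = of_rat (poly p r)"
  by (induction p) (auto simp: eval_rat_pCons of_rat_add of_rat_mult)

text \<open>Rational coefficients in the variable z^2: every such map is even and real and takes
  rational numbers to rational numbers.\<close>

definition sqpoly :: "rat poly \<Rightarrow> complex \<Rightarrow> complex" where
  "sqpoly p z = eval_rat p (z\<^sup>2)"

text \<open>The weighted l^1 norm of the coefficients. It is submultiplicative, and it bounds at
  once the values of \<open>sqpoly p\<close> on |z|^2 <= R and, for R >= 1, every single
  coefficient.\<close>

definition wnorm :: "rat \<Rightarrow> rat poly \<Rightarrow> rat" where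
  "wnorm R p = poly (map_poly abs p) R"

lemma sqpoly_0 [simp]: "sqpoly 0 z = 0"
  by (simp add: sqpoly_def)

lemma sqpoly_pCons [simp]: "sqpoly (pCons a p) z = of_rat a + z\<^sup>2 * sqpoly p z"
  by (simp add: sqpoly_def eval_rat_pCons)

lemma sqpoly_add: "sqpoly (p + q) z = sqpoly p z + sqpoly q z"
  by (simp add: sqpoly_def eval_rat_add)

lemma sqpoly_diff: "sqpoly (p - q) z = sqpoly p z - sqpoly q z"
  using sqpoly_add[of "p - q" q z] by simp

lemma sqpoly_minus_arg: "sqpoly p (- z) = sqpoly p z"
  by (simp add: sqpoly_def)

lemma of_real_of_rat [simp]: "of_real (of_rat r) = (of_rat r :: complex)"
  by (cases r) (simp add: of_rat_rat)

lemma cnj_of_rat [simp]: "cnj (of_rat r) = of_rat r"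
  by (metis complex_cnj_complex_of_real of_real_of_rat)

lemma sqpoly_cnj: "sqpoly p (cnj z) = cnj (sqpoly p z)"
  by (induction p) auto

lemma sqpoly_of_rat: "sqpoly p (of_rat r) = of_rat (poly p (r\<^sup>2))"
  by (simp add: sqpoly_def eval_rat_of_rat flip: of_rat_power)

lemma sqpoly_has_field_derivative:
  "(sqpoly p has_field_derivative 2 * z * sqpoly (pderiv p) z) (at z)"
proof (induction p)
  case 0
  then show ?case by (simp add: sqpoly_def)
next
  case (pCons a p)
  have "sqpoly (pCons a p) = (\<lambda>z. of_rat a + z\<^sup>2 * sqpoly p z)"
    by (rule ext) simp
  then show ?case
    by (auto intro!: derivative_eq_intros pCons.IH
        simp: pderiv_pCons sqpoly_add algebra_simps power2_eq_square)
qed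

lemma holomorphic_sqpoly [holomorphic_intros]: "sqpoly p holomorphic_on A"
  by (meson sqpoly_has_field_derivative field_differentiable_def holomorphic_onI
      field_differentiable_at_within)

section \<open>Estimates in the weighted coefficient norm\<close>

lemma wnorm_0 [simp]: "wnorm R 0 = 0"
  by (simp add: wnorm_def)

lemma wnorm_pCons [simp]: "wnorm R (pCons a p) = \<bar>a\<bar> + R * wnorm R p"
  by (simp add: wnorm_def map_poly_pCons)

lemma wnorm_nonneg: "0 \<le> R \<Longrightarrow> 0 \<le> wnorm R p"
  by (induction p) auto

lemma wnorm_add: "0 \<le> R \<Longrightarrow> wnorm R (p + q) \<le> wnorm R p + wnorm R q"
proof (induction p arbitrary: q)
  case (pCons a p)
  show ?case
  proof (cases q)
    case (pCons b r)
    have "R * wnorm R (p + r) \<le> R * (wnorm R p + wnorm R r)"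
      using pCons.IH[of r] pCons.prems by (intro mult_left_mono) auto
    then show ?thesis using pCons abs_triangle_ineq[of a b] by (simp add: algebra_simps)
  qed
qed simp

lemma wnorm_smult: "wnorm R (smult c p) = \<bar>c\<bar> * wnorm R p"
  by (induction p) (auto simp: abs_mult algebra_simps)

lemma wnorm_mult: "0 \<le> R \<Longrightarrow> wnorm R (p * q) \<le> wnorm R p * wnorm R q"
proof (induction p)
  case (pCons a p)
  have "wnorm R (pCons a p * q) \<le> wnorm R (smult a q) + wnorm R (pCons 0 (p * q))"
    by (simp add: wnorm_add pCons.prems del: wnorm_pCons)
  also have "\<dots> \<le> \<bar>a\<bar> * wnorm R q + R * (wnorm R p * wnorm R q)"
    using pCons.IH pCons.prems by (simp add: wnorm_smult mult_left_mono)
  finally show ?case by (simp add: algebra_simps)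
qed simp

lemma wnorm_prod: "0 \<le> R \<Longrightarrow> wnorm R (\<Prod>i\<in>A. p i) \<le> (\<Prod>i\<in>A. wnorm R (p i))"
proof (induction A rule: infinite_finite_induct)
  case (insert x F)
  have "wnorm R (p x * prod p F) \<le> wnorm R (p x) * wnorm R (prod p F)"
    by (rule wnorm_mult[OF insert.prems])
  also have "\<dots> \<le> wnorm R (p x) * (\<Prod>i\<in>F. wnorm R (p i))"
    using insert wnorm_nonneg by (intro mult_left_mono) auto
  finally show ?case using insert by simp
qed (simp_all add: one_pCons)

lemma wnorm_sum: "0 \<le> R \<Longrightarrow> wnorm R (\<Sum>i\<in>A. p i) \<le> (\<Sum>i\<in>A. wnorm R (p i))"
proof (induction A rule: infinite_finite_induct)
  case (insert x F)
  then show ?case using wnorm_add[OF insert.prems, of "p x" "sum p F"] by simp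
qed simp_all

lemma wnorm_mono: "\<lbrakk>0 \<le> R; R \<le> R'\<rbrakk> \<Longrightarrow> wnorm R p \<le> wnorm R' p"
  by (induction p) (auto intro!: mult_mono simp: wnorm_nonneg)

lemma abs_coeff_le_wnorm: "1 \<le> R \<Longrightarrow> \<bar>coeff p k\<bar> \<le> wnorm R p"
proof (induction p arbitrary: k)
  case (pCons a p)
  have *: "wnorm R p \<le> R * wnorm R p"
    using pCons.prems wnorm_nonneg[of R p] mult_right_mono[of 1 R "wnorm R p"] by simp
  show ?case
  proof (cases k)
    case 0
    then show ?thesis using * wnorm_nonneg[of R p] pCons.prems by simp
  next
    case (Suc j)
    then show ?thesis using * pCons.IH[of j] pCons.prems by simp
  qed
qed simp

lemma norm_of_rat_complex: "norm (of_rat r :: complex) = of_rat \<bar>r\<bar>"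
  by (metis abs_of_rat norm_of_real of_real_of_rat)

text \<open>The weight corresponds to |z|^2 and not to |z|, so R = 4 controls the disc of radius
  2.\<close>

lemma norm_sqpoly_le:
  assumes "(norm z)\<^sup>2 \<le> of_rat R"
  shows "norm (sqpoly p z) \<le> of_rat (wnorm R p)"
proof (induction p)
  case (pCons a p)
  have R: "0 \<le> R" using assms by (metis of_rat_0 of_rat_less_eq order_trans zero_le_power2)
  have "norm (z\<^sup>2 * sqpoly p z) \<le> of_rat R * of_rat (wnorm R p)"
    unfolding norm_mult norm_power using assms pCons.IH wnorm_nonneg[OF R]
    by (intro mult_mono) (auto simp: R)
  then show ?case
    using norm_triangle_ineq[of "of_rat a" "z\<^sup>2 * sqpoly p z"]
    by (simp add: norm_of_rat_complex of_rat_add of_rat_mult)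
qed simp

lemma sqpoly_eq_sum:
  assumes "degree p \<le> d"
  shows "sqpoly p (of_real x) = of_real (\<Sum>k\<le>d. of_rat (coeff p k) * x ^ (2 * k))"
proof -
  have deg: "degree (map_poly of_rat p :: complex poly) = degree p"
    by (rule degree_map_poly) simp
  have "sqpoly p (of_real x) = (\<Sum>k\<le>degree p. of_rat (coeff p k) * (of_real x)\<^sup>2 ^ k)"
    unfolding sqpoly_def by (simp add: poly_altdef deg coeff_map_poly)
  also have "\<dots> = (\<Sum>k\<le>d. of_rat (coeff p k) * (of_real x)\<^sup>2 ^ k)"
    using assms by (intro sum.mono_neutral_left) (auto simp: coeff_eq_0)
  finally show ?thesis by (simp add: power_mult)
qed

section \<open>Maps close to a quadratic polynomial\<close>

locale near_quadratic =
  fixes f :: "complex \<Rightarrow> complex"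
  assumes holo: "f holomorphic_on UNIV"
    and even: "f (- z) = f z"
    and real: "f (cnj z) = cnj (f z)"
    and near: "norm z \<le> 2 \<Longrightarrow> norm (f z - (4 * z\<^sup>2 - 2)) \<le> 1/100"
begin

section \<open>The restriction to the disc: location of preimages and expansion\<close>

definition dom :: "complex set" where
  "dom = {z \<in> ball 0 1. f z \<in> ball 0 1}"

lemma mem_dom_iff: "z \<in> dom \<longleftrightarrow> norm z < 1 \<and> norm (f z) < 1"
  by (auto simp: dom_def)

lemma cnj_mem_dom [simp]: "cnj z \<in> dom \<longleftrightarrow> z \<in> dom"
  by (simp add: mem_dom_iff real)

lemma continuous_on_f: "continuous_on A f"
  using holo holomorphic_on_imp_continuous_on holomorphic_on_subset by blast

lemma has_deriv: "(f has_field_derivative deriv f z) (at z)"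
  using holo holomorphic_derivI by blast

lemma open_dom: "open dom"
proof -
  have "dom = ball 0 1 \<inter> f -` ball 0 1" by (auto simp: dom_def)
  then show ?thesis
    using continuous_on_f[of UNIV] by (simp add: open_Int open_vimage)
qed

text \<open>Cauchy's estimate on the disc of radius 1 about z, which lies in the disc of radius 2
  where the error is at most 1/100.\<close>

lemma error_derivative:
  assumes "norm z \<le> 1"
  shows "norm (deriv f z - 8 * z) \<le> 1/100"
proof -
  let ?h = "\<lambda>z. f z - (4 * z\<^sup>2 - 2)"
  have hol: "?h holomorphic_on UNIV"
    by (intro holomorphic_intros holo)
  have "norm ((deriv ^^ 1) ?h z) \<le> fact 1 * (1/100) / 1 ^ 1"
  proof (rule Cauchy_inequality)
    show "?h holomorphic_on ball z 1" using hol holomorphic_on_subset by blast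
    show "continuous_on (cball z 1) ?h"
      using hol holomorphic_on_imp_continuous_on holomorphic_on_subset by blast
    fix x assume "norm (z - x) = 1"
    then have "norm x \<le> 2" using assms norm_triangle_ineq4[of z "z - x"] by simp
    then show "norm (?h x) \<le> 1/100" by (rule near)
  qed simp
  moreover have "deriv ?h z = deriv f z - 8 * z"
    by (rule DERIV_imp_deriv) (auto intro!: derivative_eq_intros has_deriv)
  ultimately show ?thesis by simp
qed

lemma error_lipschitz:
  assumes "norm z \<le> 1" "norm w \<le> 1"
  shows "norm ((f z - 4 * z\<^sup>2) - (f w - 4 * w\<^sup>2)) \<le> 1/100 * norm (z - w)"
proof (rule field_differentiable_bound[of "cball 0 1" _ "\<lambda>z. deriv f z - 8 * z"])
  show "((\<lambda>z. f z - 4 * z\<^sup>2) has_field_derivative deriv f x - 8 * x) (at x within cball 0 1)" for x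
    by (rule has_field_derivative_at_within) (auto intro!: derivative_eq_intros has_deriv)
qed (use assms error_derivative in auto)

text \<open>|4 z^2| <= 1 + 1/100 + 2, which is less than 4 (9/10)^2. This gap makes the domain
  relatively compact in the disc.\<close>

lemma norm_preimage_less:
  assumes "norm z \<le> 1" "norm (f z) \<le> 1"
  shows "norm z < 9/10"
proof -
  have "norm (4 * z\<^sup>2) \<le> norm (f z) + norm (f z - (4 * z\<^sup>2 - 2)) + norm (2::complex)"
    using norm_triangle_ineq4[of "f z" "f z - (4 * z\<^sup>2 - 2)"]
      norm_triangle_ineq[of "f z - (f z - (4 * z\<^sup>2 - 2))" 2] by simp
  also have "\<dots> \<le> 301/100" using assms near[of z] by simp
  finally have "(norm z)\<^sup>2 < (9/10)\<^sup>2" by (simp add: norm_mult norm_power power2_eq_square)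
  then show ?thesis by (rule power2_less_imp_less) simp
qed

text \<open>Re (z^2) is at least (2 - 1 - 1/100)/4 = 99/400 and at most (Re z)^2. Hence the domain
  avoids the imaginary axis and splits by the sign of Re z.\<close>

lemma abs_Re_preimage_gt:
  assumes "norm z \<le> 1" "norm (f z) \<le> 1"
  shows "12/25 < \<bar>Re z\<bar>"
proof -
  have "- Re (f z) \<le> 1" using abs_Re_le_cmod[of "f z"] assms by linarith
  moreover have "\<bar>Re (f z - (4 * z\<^sup>2 - 2))\<bar> \<le> 1/100"
    using assms by (intro order_trans[OF abs_Re_le_cmod near]) simp
  moreover have "Re (f z - (4 * z\<^sup>2 - 2)) = Re (f z) - (4 * Re (z\<^sup>2) - 2)" by simp
  ultimately have "99/400 \<le> Re (z\<^sup>2)" by linarith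
  also have "\<dots> \<le> \<bar>Re z\<bar>\<^sup>2" by (simp add: power2_eq_square)
  finally have "(12/25)\<^sup>2 < \<bar>Re z\<bar>\<^sup>2" by (simp add: power2_eq_square)
  then show ?thesis by (rule power2_less_imp_less) simp
qed

lemma Re_nonzero: "z \<in> dom \<Longrightarrow> Re z \<noteq> 0"
  using abs_Re_preimage_gt[of z] by (auto simp: mem_dom_iff)

text \<open>On one side of the imaginary axis |z + w| >= 24/25, so 4 z^2 expands distances by more
  than 3, and the error term changes this factor by at most 1/100.\<close>

lemma expanding:
  assumes "z \<in> dom" "w \<in> dom" "Re z > 0 \<longleftrightarrow> Re w > 0"
  shows "2 * norm (z - w) \<le> norm (f z - f w)"
proof -
  have "24/25 \<le> \<bar>Re (z + w)\<bar>"
    using abs_Re_preimage_gt[of z] abs_Re_preimage_gt[of w] assms by (auto simp: mem_dom_iff)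
  then have sum: "24/25 \<le> norm (z + w)" using abs_Re_le_cmod order_trans by blast
  have "norm (4 * z\<^sup>2 - 4 * w\<^sup>2) = 4 * norm (z + w) * norm (z - w)"
  proof -
    have "4 * z\<^sup>2 - 4 * w\<^sup>2 = of_real 4 * ((z + w) * (z - w))"
      by (simp add: power2_eq_square algebra_simps)
    then show ?thesis by (simp only: norm_mult norm_of_real)
  qed
  moreover have "3 * norm (z - w) \<le> 4 * norm (z + w) * norm (z - w)"
    using sum by (intro mult_right_mono) auto
  moreover have "norm (4 * z\<^sup>2 - 4 * w\<^sup>2) \<le> norm (f z - f w)
      + norm ((f z - 4 * z\<^sup>2) - (f w - 4 * w\<^sup>2))"
    using norm_triangle_ineq4[of "f z - f w" "(f z - 4 * z\<^sup>2) - (f w - 4 * w\<^sup>2)"]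
    by (simp add: algebra_simps)
  moreover have "norm ((f z - 4 * z\<^sup>2) - (f w - 4 * w\<^sup>2)) \<le> 1/100 * norm (z - w)"
    using assms by (intro error_lipschitz) (auto simp: mem_dom_iff)
  moreover have "0 \<le> norm (z - w)" by simp
  ultimately show ?thesis by linarith
qed

section \<open>Inverse branches and periodic points by itinerary\<close>

lemma preimage_exists:
  assumes "norm w \<le> 1"
  shows "\<exists>z. norm z < 9/10 \<and> f z = w \<and> (Re z > 0 \<longleftrightarrow> s)"
proof -
  \<comment> \<open>The equation f z = w reads z^2 = q z. Since q maps the unit disc into itself and
    into the right half-plane, Brouwer applies to the principal root of q.\<close>
  define q where "q z = (w - (f z - (4 * z\<^sup>2 - 2)) + 2) / 4" for z
  have q: "Re (q z) > 0" "norm (q z) \<le> 1" if "norm z \<le> 1" for z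
  proof -
    have e: "norm (f z - (4 * z\<^sup>2 - 2)) \<le> 1/100" using near that by simp
    have "- Re w \<le> 1" "Re (f z - (4 * z\<^sup>2 - 2)) \<le> 1/100"
      using abs_Re_le_cmod[of w] abs_Re_le_cmod[of "f z - (4 * z\<^sup>2 - 2)"] assms e by linarith+
    then show "Re (q z) > 0" unfolding q_def by simp
    have "norm (w - (f z - (4 * z\<^sup>2 - 2)) + 2) \<le> 4"
      using norm_triangle_ineq[of "w - (f z - (4 * z\<^sup>2 - 2))" 2]
        norm_triangle_ineq4[of w "f z - (4 * z\<^sup>2 - 2)"] assms e by simp
    then show "norm (q z) \<le> 1" unfolding q_def by (simp add: norm_divide)
  qed
  have 1: "continuous_on {z. Re z > 0} csqrt"
    by (rule continuous_on_subset[OF continuous_on_csqrt]) (auto simp: complex_nonpos_Reals_iff)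
  have 2: "continuous_on (cball 0 1) q"
    unfolding q_def by (intro continuous_intros continuous_on_f) simp
  have "continuous_on (cball 0 1) (\<lambda>z. csqrt (q z))"
    by (rule continuous_on_compose2[OF 1 2]) (use q(1) in auto)
  moreover have "(\<lambda>z. csqrt (q z)) \<in> cball 0 1 \<rightarrow> cball 0 1"
    using q(2) by (auto simp: norm_csqrt)
  ultimately obtain z where z: "norm z \<le> 1" "csqrt (q z) = z"
    using brouwer_ball[of 1 0 "\<lambda>z. csqrt (q z)"] by auto
  have "q z = z\<^sup>2" using z(2) by (metis power2_csqrt)
  then have fz: "f z = w" unfolding q_def by (simp add: field_simps)
  have "Re z \<ge> 0" using z(2) Re_csqrt by metis
  moreover have "Re z \<noteq> 0" using abs_Re_preimage_gt[of z] fz z(1) assms by auto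
  ultimately have "Re z > 0" by simp
  moreover have "norm z < 9/10" using norm_preimage_less fz z(1) assms by auto
  \<comment> \<open>The principal root gives the preimage on the right; evenness gives the one on
    the left.\<close>
  ultimately have "norm (if s then z else - z) < 9/10 \<and> f (if s then z else - z) = w \<and>
      (Re (if s then z else - z) > 0 \<longleftrightarrow> s)"
    using fz by (simp add: even)
  then show ?thesis by blast
qed

definition branch :: "bool \<Rightarrow> complex \<Rightarrow> complex" where
  "branch s w = (SOME z. norm z < 9/10 \<and> f z = w \<and> (Re z > 0 \<longleftrightarrow> s))"

lemma branch:
  assumes "norm w < 1"
  shows "norm (branch s w) < 9/10" "f (branch s w) = w" "Re (branch s w) > 0 \<longleftrightarrow> s"
    "branch s w \<in> dom"
proof -
  have *: "norm (branch s w) < 9/10 \<and> f (branch s w) = w \<and> (Re (branch s w) > 0 \<longleftrightarrow> s)"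
    unfolding branch_def by (rule someI_ex[OF preimage_exists]) (use assms in simp)
  then show "norm (branch s w) < 9/10" "f (branch s w) = w" "Re (branch s w) > 0 \<longleftrightarrow> s"
    by blast+
  have "norm (branch s w) < 1" using * by linarith
  moreover have "norm (f (branch s w)) < 1" using * assms by metis
  ultimately show "branch s w \<in> dom" unfolding mem_dom_iff by blast
qed

text \<open>Two preimages on the same side have equal images, so expansion forces them to
  coincide.\<close>

lemma branch_unique:
  assumes "z \<in> dom" "Re z > 0 \<longleftrightarrow> s"
  shows "branch s (f z) = z"
  using expanding[of "branch s (f z)" z] branch[of "f z" s] assms by (auto simp: mem_dom_iff)

lemma continuous_on_branch: "continuous_on (ball 0 1) (branch s)"
proof (rule continuous_on_subset[OF lipschitz_on_continuous_on subset_refl])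
  show "(1/2)-lipschitz_on (ball 0 1) (branch s)"
  proof (rule lipschitz_onI)
    fix x y :: complex assume "x \<in> ball 0 1" "y \<in> ball 0 1"
    then show "dist (branch s x) (branch s y) \<le> 1/2 * dist x y"
      using expanding[of "branch s x" "branch s y"] branch[of x s] branch[of y s]
      by (simp add: dist_norm)
  qed simp
qed

text \<open>The map g is a composition of n inverse branches. The branch for \<sigma> 0 is applied
  last, so the induction uses the shifted itinerary. The closed disc of radius 9/10 is mapped into
  itself, as Brouwer's theorem requires.\<close>

lemma pullback_exists:
  "\<exists>g. continuous_on (cball 0 (9/10)) g \<and> g \<in> cball 0 (9/10) \<rightarrow> cball 0 (9/10) \<and>
    (\<forall>w\<in>cball 0 (9/10). (f ^^ n) (g w) = w \<and>
      (\<forall>k<n. (f ^^ k) (g w) \<in> dom \<and> (Re ((f ^^ k) (g w)) > 0 \<longleftrightarrow> \<sigma> k)))"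
proof (induction n arbitrary: \<sigma>)
  case 0
  show ?case by (rule exI[of _ "\<lambda>w. w"]) auto
next
  case (Suc n)
  obtain g where g: "continuous_on (cball 0 (9/10)) g" "g \<in> cball 0 (9/10) \<rightarrow> cball 0 (9/10)"
    and it: "\<And>w. w \<in> cball 0 (9/10) \<Longrightarrow> (f ^^ n) (g w) = w"
      "\<And>w k. \<lbrakk>w \<in> cball 0 (9/10); k < n\<rbrakk> \<Longrightarrow> (f ^^ k) (g w) \<in> dom \<and> (Re ((f ^^ k) (g w)) > 0 \<longleftrightarrow> \<sigma> (Suc k))"
    using Suc.IH[of "\<sigma> \<circ> Suc"] by (auto simp: comp_def)
  have lt: "norm (g w) < 1" if "w \<in> cball 0 (9/10)" for w
  proof -
    have "norm (g w) \<le> 9/10" using funcset_mem[OF g(2) that] by simp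
    then show ?thesis by simp
  qed
  let ?g = "\<lambda>w. branch (\<sigma> 0) (g w)"
  have "continuous_on (cball 0 (9/10)) ?g"
    using lt by (intro continuous_on_compose2[OF continuous_on_branch g(1)]) auto
  moreover have "?g \<in> cball 0 (9/10) \<rightarrow> cball 0 (9/10)"
    using branch(1)[OF lt] by (auto simp: less_imp_le)
  moreover have "(f ^^ Suc n) (?g w) = w" if "w \<in> cball 0 (9/10)" for w
    using it(1)[OF that] branch(2)[OF lt[OF that]] by (simp add: funpow_Suc_right del: funpow.simps)
  moreover have "(f ^^ k) (?g w) \<in> dom \<and> (Re ((f ^^ k) (?g w)) > 0 \<longleftrightarrow> \<sigma> k)"
    if "w \<in> cball 0 (9/10)" "k < Suc n" for w k
  proof (cases k)
    case 0
    then show ?thesis using branch[OF lt[OF that(1)]] by simp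
  next
    case (Suc j)
    then show ?thesis using it(2)[OF that(1), of j] branch(2)[OF lt[OF that(1)]] that(2)
      by (simp add: funpow_Suc_right del: funpow.simps)
  qed
  ultimately show ?case by blast
qed

text \<open>The period only has to divide n. For n = 0 the set is the whole plane, hence the
  assumption n >= 1 in what follows.\<close>

definition cyc :: "nat \<Rightarrow> complex set" where
  "cyc n = {z. (f ^^ n) z = z \<and> (\<forall>k<n. (f ^^ k) z \<in> dom)}"

text \<open>A Brouwer fixed point of the pullback along \<sigma> is periodic with itinerary
  \<sigma>.\<close>

lemma cyc_exists: "\<exists>z\<in>cyc n. \<forall>k<n. Re ((f ^^ k) z) > 0 \<longleftrightarrow> \<sigma> k"
proof -
  obtain g where g: "continuous_on (cball 0 (9/10)) g" "g \<in> cball 0 (9/10) \<rightarrow> cball 0 (9/10)"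
    and it: "\<forall>w\<in>cball 0 (9/10). (f ^^ n) (g w) = w \<and>
      (\<forall>k<n. (f ^^ k) (g w) \<in> dom \<and> (Re ((f ^^ k) (g w)) > 0 \<longleftrightarrow> \<sigma> k))"
    using pullback_exists by metis
  obtain z where "z \<in> cball 0 (9/10)" "g z = z"
    using brouwer_ball[OF _ g] by auto
  then have "(f ^^ n) z = z" "\<And>k. k < n \<Longrightarrow> (f ^^ k) z \<in> dom"
    "\<And>k. k < n \<Longrightarrow> Re ((f ^^ k) z) > 0 \<longleftrightarrow> \<sigma> k"
    using it by metis+
  then show ?thesis by (auto simp: cyc_def intro!: bexI[of _ z])
qed

lemma expanding_iterate:
  assumes "\<And>k. k < n \<Longrightarrow> (f ^^ k) z \<in> dom" "\<And>k. k < n \<Longrightarrow> (f ^^ k) w \<in> dom"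
    "\<And>k. k < n \<Longrightarrow> Re ((f ^^ k) z) > 0 \<longleftrightarrow> Re ((f ^^ k) w) > 0"
  shows "2 ^ n * norm (z - w) \<le> norm ((f ^^ n) z - (f ^^ n) w)"
  using assms
proof (induction n)
  case (Suc n)
  have "2 * (2 ^ n * norm (z - w)) \<le> 2 * norm ((f ^^ n) z - (f ^^ n) w)"
    using Suc by simp
  also have "\<dots> \<le> norm ((f ^^ Suc n) z - (f ^^ Suc n) w)"
    using expanding Suc.prems by simp
  finally show ?case by simp
qed simp

text \<open>The n-th iterate fixes both points, yet with equal itineraries it expands their distance
  by 2^n > 1.\<close>

lemma cyc_eqI:
  assumes "n \<ge> 1" "z \<in> cyc n" "w \<in> cyc n"
    "\<And>k. k < n \<Longrightarrow> Re ((f ^^ k) z) > 0 \<longleftrightarrow> Re ((f ^^ k) w) > 0"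
  shows "z = w"
proof (rule ccontr)
  assume "z \<noteq> w"
  moreover have "2 ^ n * norm (z - w) \<le> 1 * norm (z - w)"
    using expanding_iterate[of n z w] assms by (auto simp: cyc_def)
  ultimately have "(2::real) ^ n \<le> 1"
    by (simp only: mult_le_cancel_right) simp
  moreover have "(2::real) ^ 1 \<le> 2 ^ n" using assms(1) by (intro power_increasing) auto
  ultimately show False by simp
qed

lemma finite_cyc:
  assumes "n \<ge> 1"
  shows "finite (cyc n)" "card (cyc n) \<le> 2 ^ n"
proof -
  \<comment> \<open>The itinerary, encoded as the set of times spent on the right; it determines the
    point.\<close>
  let ?s = "\<lambda>z. {k. k < n \<and> Re ((f ^^ k) z) > 0}"
  have inj: "inj_on ?s (cyc n)"
    using assms by (intro inj_onI cyc_eqI[of n]) (auto simp: set_eq_iff)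
  have sub: "?s ` cyc n \<subseteq> Pow {..<n}" by auto
  show "finite (cyc n)" using inj_on_finite[OF inj sub] by simp
  show "card (cyc n) \<le> 2 ^ n"
    using card_inj_on_le[OF inj sub] by (simp add: card_Pow)
qed

lemma iterate_cnj: "(f ^^ k) (cnj z) = cnj ((f ^^ k) z)"
  by (induction k) (auto simp: real)

text \<open>Conjugation preserves real parts, so the conjugate point has the same itinerary.\<close>

lemma cyc_real:
  assumes "n \<ge> 1" "z \<in> cyc n"
  shows "z \<in> \<real>"
proof -
  have "cnj z = z"
    using assms by (intro cyc_eqI[of n]) (auto simp: cyc_def iterate_cnj)
  then show ?thesis by (simp add: Reals_cnj_iff)
qed

lemma f_mem_cyc:
  assumes "n \<ge> 1" "z \<in> cyc n"
  shows "f z \<in> cyc n"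
proof -
  have "(f ^^ k) (f z) \<in> dom" if "k < n" for k
  proof (cases "Suc k = n")
    case True
    then have "(f ^^ k) (f z) = z" using assms(2) by (auto simp: cyc_def funpow_swap1)
    then show ?thesis using assms unfolding cyc_def by force
  next
    case False
    then have "Suc k < n" using that by simp
    then have "(f ^^ Suc k) z \<in> dom" using assms(2) unfolding cyc_def by blast
    then show ?thesis by (simp add: funpow_swap1)
  qed
  moreover have "(f ^^ n) (f z) = f z" using assms(2) by (metis (mono_tags) cyc_def funpow_swap1 mem_Collect_eq)
  ultimately show ?thesis by (simp add: cyc_def)
qed

lemma cyc_inj:
  assumes "n \<ge> 1" "z \<in> cyc n" "w \<in> cyc n" "f z = f w"
  shows "z = w"
proof -
  obtain m where "n = Suc m" using assms(1) by (cases n) auto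
  then have "(f ^^ n) z = (f ^^ n) w" using assms(4) by (simp add: funpow_swap1)
  then show ?thesis using assms by (simp add: cyc_def)
qed

text \<open>Ensures that the interpolation nodes, which are squares of periodic points, are
  distinct.\<close>

lemma cyc_power2_inj:
  assumes "n \<ge> 1" "z \<in> cyc n" "w \<in> cyc n" "z\<^sup>2 = w\<^sup>2"
  shows "z = w"
proof -
  have "f z = f w" using assms(4) even by (auto simp: power2_eq_iff)
  then show ?thesis using cyc_inj assms by blast
qed

lemma cyc_subset_dom: "n \<ge> 1 \<Longrightarrow> cyc n \<subseteq> dom"
  unfolding cyc_def by force

section \<open>The degree two covering of the disc, and the obstruction to an affine model\<close>

definition half :: "bool \<Rightarrow> complex set" where
  "half s = {z \<in> dom. Re z > 0 \<longleftrightarrow> s}"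

lemma half_eq_image: "half s = branch s ` ball 0 1"
proof (intro equalityI subsetI)
  fix z assume "z \<in> half s"
  then have "z = branch s (f z)" "f z \<in> ball 0 1"
    using branch_unique[of z s] by (auto simp: half_def mem_dom_iff)
  then show "z \<in> branch s ` ball 0 1" by blast
qed (use branch in \<open>auto simp: half_def\<close>)

lemma connected_half: "connected (half s)"
  unfolding half_eq_image by (intro connected_continuous_image continuous_on_branch) auto

lemma open_half: "open (half s)"
proof (cases s)
  case True
  then have "half s = dom \<inter> {z. Re z > 0}" by (auto simp: half_def)
  then show ?thesis by (simp add: open_Int open_dom open_halfspace_Re_gt)
next
  case False
  then have "half s = dom \<inter> {z. Re z < 0}"
    using Re_nonzero by (force simp: half_def)
  then show ?thesis by (simp add: open_Int open_dom open_halfspace_Re_lt)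
qed

lemma homeomorphism_half: "homeomorphism (half s) (ball 0 1) f (branch s)"
proof
  show "f ` half s \<subseteq> ball 0 1" by (auto simp: half_def mem_dom_iff)
qed (use branch branch_unique in \<open>auto simp: half_def intro: continuous_on_f continuous_on_branch\<close>)

text \<open>The whole disc is evenly covered, with the two halves as sheets.\<close>

lemma covering_space_dom: "covering_space dom f (ball 0 1)"
proof
  show "continuous_on dom f" by (rule continuous_on_f)
  show "f ` dom = ball 0 1"
  proof (intro equalityI subsetI)
    fix w :: complex assume "w \<in> ball 0 1"
    then show "w \<in> f ` dom" using branch[of w True] by (metis image_eqI mem_ball_0)
  qed (auto simp: mem_dom_iff)
  fix x :: complex assume "x \<in> ball 0 1"
  have "\<Union>{half True, half False} = dom \<inter> f -` ball 0 1"
    by (auto simp: half_def mem_dom_iff)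
  moreover have "openin (top_of_set dom) (half s)" for s
    using open_half by (auto simp: openin_open half_def)
  moreover have "pairwise disjnt {half True, half False}"
    by (auto simp: pairwise_def disjnt_iff half_def)
  moreover have "\<exists>q. homeomorphism (half s) (ball 0 1) f q" for s
    using homeomorphism_half by blast
  ultimately show "\<exists>T. x \<in> T \<and> openin (top_of_set (ball 0 1)) T \<and>
      (\<exists>v. \<Union>v = dom \<inter> f -` T \<and> (\<forall>u\<in>v. openin (top_of_set dom) u) \<and> pairwise disjnt v \<and>
        (\<forall>u\<in>v. \<exists>q. homeomorphism u T f q))"
    using \<open>x \<in> ball 0 1\<close>
    by (intro exI[of _ "ball 0 1"] conjI exI[of _ "{half True, half False}"]) auto
qed

lemma escaping_quadratic_like_dom: "escaping_quadratic_like f dom (ball 0 1)"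
  unfolding escaping_quadratic_like_def
proof (intro conjI ballI)
  have sub: "dom \<subseteq> cball 0 (9/10)"
    using norm_preimage_less by (auto simp: mem_dom_iff less_imp_le intro!: less_imp_le[of _ "9/10"])
  then have "closure dom \<subseteq> cball 0 (9/10)" by (simp add: closure_minimal)
  then show "closure dom \<subseteq> ball 0 1" by (rule order_trans) auto
  show "compact (closure dom)" using sub bounded_subset[OF bounded_cball] by auto
  show "dom \<noteq> {}" using branch(4)[of 0 True] by auto
  show "f holomorphic_on dom" using holo holomorphic_on_subset by blast
  show "simply_connected (ball 0 1 :: complex set)"
    by (simp add: convex_imp_simply_connected)
  show "card {z \<in> dom. f z = w} = 2" if "w \<in> ball 0 1" for w
  proof -
    have "{z \<in> dom. f z = w} = {branch True w, branch False w}"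
    proof (intro equalityI subsetI)
      fix z assume "z \<in> {z \<in> dom. f z = w}"
      then show "z \<in> {branch True w, branch False w}"
        using branch_unique[of z True] branch_unique[of z False] by (cases "Re z > 0") auto
    qed (use branch that in auto)
    moreover have "branch True w \<noteq> branch False w"
      using branch(3)[of w True] branch(3)[of w False] that by auto
    ultimately show ?thesis by simp
  qed
qed (auto simp: open_dom covering_space_dom)

text \<open>With \<open>c = 1\<close> the points are fixed, with \<open>c = -1\<close> they form a 2-cycle. The two products of
  derivatives are near \<open>-32\<close> and \<open>-28\<close>, but would agree if the two branches were affine.\<close>

lemma deriv_product_near:
  assumes "x \<in> dom" "y \<in> dom" "x \<noteq> y" "c\<^sup>2 = 1"
    and diff: "f x - f y = c * (x - y)" and sum: "f x + f y = x + y"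
  shows "norm (deriv f x * deriv f y + 30 + 2 * c) < 1"
proof -
  define hx hy dx dy \<delta> where "hx = f x - (4 * x\<^sup>2 - 2)" "hy = f y - (4 * y\<^sup>2 - 2)"
    "dx = deriv f x - 8 * x" "dy = deriv f y - 8 * y" "\<delta> = 4 * (x + y) - c"
  note defs = this
  have n: "norm x < 1" "norm y < 1" using assms by (auto simp: mem_dom_iff)
  have h: "norm hx \<le> 1/100" "norm hy \<le> 1/100" using near n by (auto simp: defs)
  have d: "norm dx \<le> 1/100" "norm dy \<le> 1/100" using error_derivative n by (auto simp: defs)
  \<comment> \<open>Dividing the difference of the two values by x - y leaves 4 (x + y) = c up to an
    error of 1/100.\<close>
  have "\<delta> * (x - y) = - ((f x - 4 * x\<^sup>2) - (f y - 4 * y\<^sup>2))"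
    unfolding defs using diff by (simp add: power2_eq_square algebra_simps)
  then have "norm \<delta> * norm (x - y) \<le> 1/100 * norm (x - y)"
    using error_lipschitz[of x y] n by (metis less_imp_le norm_minus_cancel norm_mult)
  then have \<delta>: "norm \<delta> \<le> 1/100" using \<open>x \<noteq> y\<close> by (simp add: mult_le_cancel_right)
  have c: "norm c = 1" using \<open>c\<^sup>2 = 1\<close> by (auto simp: power2_eq_1_iff)
  \<comment> \<open>With x + y = (c + \<delta>)/4, the sum equation gives 64 x y = 2 (c +
    \<delta>)^2 - 2 (c + \<delta>) - 32 + 8 hx + 8 hy, whose main term is -30 - 2 c because c^2 =
    1.\<close>
  have "deriv f x * deriv f y + 30 + 2 * c =
      4 * c * \<delta> + 2 * \<delta>\<^sup>2 + - (2 * \<delta>) + 8 * hx + 8 * hy + 8 * x * dy + 8 * y * dx + dx * dy"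
    unfolding defs using \<open>c\<^sup>2 = 1\<close> sum by algebra
  also have "norm \<dots> \<le> norm (4 * c * \<delta>) + norm (2 * \<delta>\<^sup>2) + norm (- (2 * \<delta>)) + norm (8 * hx)
      + norm (8 * hy) + norm (8 * x * dy) + norm (8 * y * dx) + norm (dx * dy)"
    by (intro norm_triangle_le add_mono order_refl)
  also have "\<dots> \<le> 4 * (1/100) + 2 * (1/100)\<^sup>2 + 2 * (1/100) + 8 * (1/100) + 8 * (1/100)
      + 8 * 1 * (1/100) + 8 * 1 * (1/100) + (1/100) * (1/100)"
    unfolding norm_mult norm_minus_cancel norm_power using h d \<delta> c n
    by (intro add_mono mult_mono power_mono) auto
  also have "\<dots> < 1" by (simp add: power2_eq_square)
  finally show ?thesis .
qed

text \<open>Differentiating the affine relation on \<open>half s\<close> gives \<phi>'(f z) f'(z) =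
  A s \<phi>'(z). Hence A s is the multiplier of the fixed point in that half, and along the 2-cycle
  the values of \<phi>' cancel, leaving A True * A False. The estimates of
  \<open>deriv_product_near\<close> exclude this equality.\<close>

lemma not_conj_affine_dom: "\<not> conj_affine_eql f dom (ball 0 1)"
proof
  assume "conj_affine_eql f dom (ball 0 1)"
  then obtain \<phi> where \<phi>: "\<phi> holomorphic_on ball 0 1" "inj_on \<phi> (ball 0 1)"
    and aff: "\<And>C. C \<in> components (\<phi> ` dom) \<Longrightarrow>
      \<exists>a b. \<forall>w\<in>C. \<phi> (f (inv_into (ball 0 1) \<phi> w)) = a * w + b"
    unfolding conj_affine_eql_def by auto
  have reg: "deriv \<phi> z \<noteq> 0" if "norm z < 1" for z
    using holomorphic_injective_imp_regular[OF \<phi>(1) _ \<phi>(2)] that by simp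
  have "\<exists>a. \<forall>z\<in>half s. deriv \<phi> (f z) * deriv f z = a * deriv \<phi> z" for s
  proof -
    have sub: "half s \<subseteq> dom" "dom \<subseteq> ball 0 1" by (auto simp: half_def dom_def)
    have "half s \<noteq> {}" by (simp add: half_eq_image)
    moreover have "connected (\<phi> ` half s)"
      using \<phi>(1) sub connected_half
      by (meson connected_continuous_image continuous_on_subset holomorphic_on_imp_continuous_on)
    \<comment> \<open>A connected image lies in a single component, so one affine formula serves the
      whole half.\<close>
    ultimately obtain C where C: "C \<in> components (\<phi> ` dom)" "\<phi> ` half s \<subseteq> C"
      using exists_component_superset[of "\<phi> ` half s" "\<phi> ` dom"] sub by blast
    obtain a b where ab: "\<And>w. w \<in> C \<Longrightarrow> \<phi> (f (inv_into (ball 0 1) \<phi> w)) = a * w + b"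
      using aff[OF C(1)] by auto
    have eq: "\<phi> (f z) = a * \<phi> z + b" if "z \<in> half s" for z
    proof -
      have "z \<in> ball 0 1" "\<phi> z \<in> C" using that sub C(2) by blast+
      then show ?thesis using ab[of "\<phi> z"] inv_into_f_f[OF \<phi>(2)] by metis
    qed
    have "deriv \<phi> (f z) * deriv f z = a * deriv \<phi> z" if z: "z \<in> half s" for z
    proof (rule DERIV_unique)
      have nz: "norm z < 1" "norm (f z) < 1" using z by (auto simp: half_def mem_dom_iff)
      have d\<phi>: "(\<phi> has_field_derivative deriv \<phi> x) (at x)" if "norm x < 1" for x
        using \<phi>(1) that by (intro holomorphic_derivI[of _ "ball 0 1"]) auto
      show "((\<lambda>z. a * \<phi> z + b) has_field_derivative a * deriv \<phi> z) (at z)"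
        by (auto intro!: derivative_eq_intros d\<phi> nz)
      have "((\<lambda>z. \<phi> (f z)) has_field_derivative deriv \<phi> (f z) * deriv f z) (at z)"
        by (rule DERIV_chain2[OF d\<phi>[OF nz(2)] has_deriv])
      then show "((\<lambda>z. a * \<phi> z + b) has_field_derivative deriv \<phi> (f z) * deriv f z) (at z)"
        using eq by (rule has_field_derivative_transform_within_open[OF _ open_half z])
    qed
    then show ?thesis by blast
  qed
  then obtain A where A: "\<And>s z. z \<in> half s \<Longrightarrow> deriv \<phi> (f z) * deriv f z = A s * deriv \<phi> z"
    by metis
  have fixed: "\<exists>p\<in>half s. f p = p" for s
    using cyc_exists[of 1 "\<lambda>_. s"] by (auto simp: cyc_def half_def)
  obtain p where p: "\<And>s. p s \<in> half s" "\<And>s. f (p s) = p s" using fixed by metis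
  have dp: "deriv f (p s) = A s" for s
    using A[OF p(1)[of s]] reg[of "p s"] p by (auto simp: half_def mem_dom_iff)
  obtain q where q: "q \<in> cyc 2" "\<And>k. k < 2 \<Longrightarrow> Re ((f ^^ k) q) > 0 \<longleftrightarrow> k = 0"
    using cyc_exists[of 2 "\<lambda>k. k = 0"] by blast
  have q2: "f (f q) = q" "q \<in> half True" "f q \<in> half False"
    using q(1) q(2)[of 0] q(2)[of 1] by (auto simp: cyc_def half_def numeral_2_eq_2 less_Suc_eq)
  have "deriv \<phi> (f q) * deriv f q = A True * deriv \<phi> q"
    "deriv \<phi> q * deriv f (f q) = A False * deriv \<phi> (f q)"
    using A[OF q2(2)] A[OF q2(3)] q2(1) by auto
  moreover have "deriv \<phi> q \<noteq> 0" "deriv \<phi> (f q) \<noteq> 0"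
    using q2 by (auto intro!: reg simp: half_def mem_dom_iff)
  ultimately have "deriv f q * deriv f (f q) = A True * A False"
    by algebra
  then have eq: "deriv f q * deriv f (f q) = deriv f (p True) * deriv f (p False)"
    by (simp add: dp)
  have "norm (deriv f (p True) * deriv f (p False) + 30 + 2 * 1) < 1"
    using p(1)[of True] p(1)[of False] p(2)
    by (intro deriv_product_near) (auto simp: half_def)
  then have 1: "norm (deriv f q * deriv f (f q) + 32) < 1" by (simp add: eq add.commute)
  have "norm (deriv f q * deriv f (f q) + 30 + 2 * (- 1)) < 1"
    using q2 by (intro deriv_product_near) (auto simp: half_def)
  then have 2: "norm (deriv f q * deriv f (f q) + 28) < 1" by (simp add: add.commute)
  show False
    \<comment> \<open>The same number would be at distance less than 1 from both -32 and
      -28.\<close>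
    using norm_triangle_ineq4[of "deriv f q * deriv f (f q) + 32" "deriv f q * deriv f (f q) + 28"] 1 2
    by simp
qed

section \<open>Periodic points on the real line\<close>

lemma periodic_point_dom_iff: "periodic_point f dom z \<longleftrightarrow> (\<exists>n\<ge>1. z \<in> cyc n)"
  by (auto simp: periodic_point_def cyc_def)

lemma abs_less_real_image:
  assumes convex: "convex_on UNIV (\<lambda>x::real. Re (f (complex_of_real x)))"
    and "z \<in> \<real>" "norm z \<ge> 1"
  shows "norm z < norm (f z)"
proof -
  obtain x where x: "z = of_real x" using \<open>z \<in> \<real>\<close> Reals_cases by blast
  let ?g = "\<lambda>x::real. Re (f (of_real x))"
  have "\<bar>?g 0 + 2\<bar> \<le> 1/100" "\<bar>?g 1 - 2\<bar> \<le> 1/100"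
    using abs_Re_le_cmod[of "f 0 + 2"] near[of 0] abs_Re_le_cmod[of "f 1 - 2"] near[of 1] by auto
  then have g: "?g 0 \<le> - 3/2" "?g 1 \<ge> 3/2" unfolding abs_le_iff by linarith+
  have ge: "1 \<le> \<bar>x\<bar>" using assms(3) x by simp
  \<comment> \<open>The point 1 is a convex combination of 0 and |x|. As g is below -3/2 at 0 and
    above 3/2 at 1, convexity forces g(|x|) >= 3 |x| - 3/2 > |x|.\<close>
  have "?g ((1 - 1/\<bar>x\<bar>) *\<^sub>R 0 + (1/\<bar>x\<bar>) *\<^sub>R \<bar>x\<bar>) \<le> (1 - 1/\<bar>x\<bar>) * ?g 0 + 1/\<bar>x\<bar> * ?g \<bar>x\<bar>"
    using ge by (intro convex_onD[OF convex]) auto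
  moreover have "(1 - 1/\<bar>x\<bar>) *\<^sub>R 0 + (1/\<bar>x\<bar>) *\<^sub>R \<bar>x\<bar> = 1" using ge by auto
  ultimately have "?g 1 \<le> (1 - 1/\<bar>x\<bar>) * ?g 0 + 1/\<bar>x\<bar> * ?g \<bar>x\<bar>" by (simp only:)
  then have "\<bar>x\<bar> * ?g 1 \<le> \<bar>x\<bar> * ((1 - 1/\<bar>x\<bar>) * ?g 0 + 1/\<bar>x\<bar> * ?g \<bar>x\<bar>)"
    by (intro mult_left_mono) auto
  also have "\<dots> = (\<bar>x\<bar> - 1) * ?g 0 + ?g \<bar>x\<bar>" using ge by (auto simp: field_simps)
  finally have "\<bar>x\<bar> * ?g 1 \<le> (\<bar>x\<bar> - 1) * ?g 0 + ?g \<bar>x\<bar>" .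
  moreover have "(\<bar>x\<bar> - 1) * ?g 0 \<le> (\<bar>x\<bar> - 1) * (- 3/2)"
    using ge g by (intro mult_left_mono) auto
  moreover have "\<bar>x\<bar> * (3/2) \<le> \<bar>x\<bar> * ?g 1" using g by (intro mult_left_mono) auto
  ultimately have "\<bar>x\<bar> < ?g \<bar>x\<bar>" using ge by argo
  also have "\<dots> \<le> norm (f (of_real \<bar>x\<bar>))" by (rule complex_Re_le_cmod)
  also have "f (of_real \<bar>x\<bar>) = f z" using even[of z] x by (auto simp: abs_if)
  finally show ?thesis using x by simp
qed

text \<open>A real orbit that reached modulus 1 or more would strictly increase in modulus from then
  on and could not close up. Conversely, cycles in the domain are real by
  \<open>cyc_real\<close>.\<close>

lemma periodic_point_Reals_iff:
  assumes "convex_on UNIV (\<lambda>x::real. Re (f (complex_of_real x)))"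
  shows "periodic_point f \<real> z \<longleftrightarrow> periodic_point f dom z"
proof
  assume "periodic_point f dom z"
  then obtain n where n: "n \<ge> 1" "z \<in> cyc n" by (auto simp: periodic_point_dom_iff)
  have "(f ^^ k) z \<in> cyc n" for k
    using n by (induction k) (auto simp: f_mem_cyc)
  then show "periodic_point f \<real> z"
    using n cyc_real by (auto simp: periodic_point_def cyc_def)
next
  assume "periodic_point f \<real> z"
  then obtain n where n: "n \<ge> 1" "(f ^^ n) z = z" "\<And>k. k < n \<Longrightarrow> (f ^^ k) z \<in> \<real>"
    by (auto simp: periodic_point_def)
  have real': "(f ^^ k) z \<in> \<real>" for k
    using n(3)[of 0] n(1) by (induction k) (auto simp: Reals_cnj_iff simp flip: real)
  have per: "(f ^^ n) ((f ^^ k) z) = (f ^^ k) z" for k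
    using n(2) by (metis add.commute comp_apply funpow_add)
  have lt: "norm ((f ^^ k) z) < 1" for k
  proof (rule ccontr)
    assume "\<not> norm ((f ^^ k) z) < 1"
    then have ge: "norm ((f ^^ k) z) \<ge> 1" by simp
    have "norm ((f ^^ k) z) \<le> norm ((f ^^ (k + j)) z) \<and>
        (j > 0 \<longrightarrow> norm ((f ^^ k) z) < norm ((f ^^ (k + j)) z))" for j
    proof (induction j)
      case (Suc j)
      then have "norm ((f ^^ (k + j)) z) < norm (f ((f ^^ (k + j)) z))"
        using ge by (intro abs_less_real_image[OF assms real']) auto
      then show ?case using Suc by auto
    qed simp
    from this[of n] have "norm ((f ^^ k) z) < norm ((f ^^ n) ((f ^^ k) z))"
      using n(1) by (simp add: add.commute[of k] funpow_add)
    then show False using per by simp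
  qed
  have "(f ^^ k) z \<in> dom" for k
    using lt[of k] lt[of "Suc k"] by (simp add: mem_dom_iff)
  then show "periodic_point f dom z" using n by (auto simp: periodic_point_def)
qed

end

section \<open>Perturbing the coefficients\<close>

lemma sqpoly_of_real: "sqpoly p (of_real x) = of_real (eval_rat p (x\<^sup>2))"
  by (induction p) (auto simp: eval_rat_pCons)

text \<open>Double zeros freeze value and derivative together. Each s has its own factor even when
  -s also lies in S; a zero of higher order does no harm and the degree stays 2 * card S.\<close>

definition vanishing :: "rat set \<Rightarrow> rat poly" where
  "vanishing S = (\<Prod>s\<in>S. [:- (s\<^sup>2), 1:]\<^sup>2)"

lemma vanishing_nonzero: "finite S \<Longrightarrow> vanishing S \<noteq> 0"
  by (auto simp: vanishing_def)

lemma degree_vanishing: "degree (vanishing S) = 2 * card S"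
  unfolding vanishing_def by (subst degree_prod_eq_sum_degree) (auto simp: degree_power_eq)

lemma eval_rat_vanishing:
  "eval_rat (vanishing S) x = (\<Prod>s\<in>S. (x - of_rat (s\<^sup>2))\<^sup>2)"
  unfolding vanishing_def
  by (induction S rule: infinite_finite_induct)
    (auto simp: eval_rat_mult eval_rat_pCons power2_eq_square[of "[:_, _:]"]
      power2_eq_square[of "_ - _"] one_pCons of_rat_minus simp del: mult_pCons_left mult_pCons_right)

lemma vanishing_mono: "\<lbrakk>finite S'; S \<subseteq> S'\<rbrakk> \<Longrightarrow> vanishing S dvd vanishing S'"
  unfolding vanishing_def by (rule prod_dvd_prod_subset)

lemma vanishing_dvdD:
  assumes "vanishing S dvd q" "finite S" "s \<in> S"
  shows "poly q (s\<^sup>2) = 0" "poly (pderiv q) (s\<^sup>2) = 0"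
proof -
  have "[:- (s\<^sup>2), 1:]\<^sup>2 dvd vanishing S"
    unfolding vanishing_def using assms by (intro dvd_prodI) auto
  then obtain r where "q = [:- (s\<^sup>2), 1:] * ([:- (s\<^sup>2), 1:] * r)"
    using assms(1) unfolding power2_eq_square[of "[:_, _:]"] by (metis dvdE dvd_trans mult.assoc)
  then show "poly q (s\<^sup>2) = 0" "poly (pderiv q) (s\<^sup>2) = 0"
    by (simp_all add: pderiv_mult del: mult_pCons_left)
qed

text \<open>The constant coefficient is exempt: it stays near -2 and does not affect
  convexity.\<close>

definition positive_coeffs :: "nat \<Rightarrow> rat poly \<Rightarrow> bool" where
  "positive_coeffs d p \<longleftrightarrow> degree p \<le> d \<and> (\<forall>k\<in>{1..d}. coeff p k > 0)"

lemma positive_coeffs_lower_bound: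
  assumes "positive_coeffs d p"
  obtains \<mu> where "\<mu> > 0" "\<And>k. k \<in> {1..d} \<Longrightarrow> \<mu> \<le> coeff p k"
proof
  \<comment> \<open>The extra 1 keeps the set nonempty when d = 0.\<close>
  let ?M = "insert 1 (coeff p ` {1..d})"
  show "Min ?M > 0" using assms by (auto simp: positive_coeffs_def)
  show "Min ?M \<le> coeff p k" if "k \<in> {1..d}" for k using that by (intro Min_le) auto
qed

lemma positive_coeffs_perturb:
  assumes "positive_coeffs d p"
  obtains \<mu> where "\<mu> > 0"
    "\<And>q R. \<lbrakk>degree q \<le> d; 1 \<le> R; wnorm R q < \<mu>\<rbrakk> \<Longrightarrow> positive_coeffs d (p + q)"
proof -
  obtain \<mu> where \<mu>: "\<mu> > 0" "\<And>k. k \<in> {1..d} \<Longrightarrow> \<mu> \<le> coeff p k"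
    using positive_coeffs_lower_bound[OF assms] by blast
  have "positive_coeffs d (p + q)" if "degree q \<le> d" "1 \<le> R" "wnorm R q < \<mu>" for q R
    unfolding positive_coeffs_def
  proof (intro conjI ballI)
    show "degree (p + q) \<le> d" using assms that by (auto simp: positive_coeffs_def intro: degree_add_le)
    fix k assume "k \<in> {1..d}"
    then show "coeff (p + q) k > 0"
      using \<mu>(2)[of k] abs_coeff_le_wnorm[OF that(2), of q k] that(3) by simp
  qed
  with \<mu>(1) that show thesis by blast
qed

text \<open>The correction is \<eta> (w^(d+1) - r) with r the remainder modulo D. It is divisible by
  D, supplies the positive coefficient at d + 1, and disturbs the others only by \<eta> r, of degree
  at most d.\<close>

lemma raise_degree:
  assumes p: "positive_coeffs d p" and D: "D \<noteq> 0" "degree D \<le> d + 1" and "1 \<le> R" "\<epsilon> > 0"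
  shows "\<exists>p'. positive_coeffs (d + 1) p' \<and> D dvd p' - p \<and> wnorm R (p' - p) < \<epsilon>"
proof -
  define r where "r = monom 1 (d + 1) mod D"
  define u where "u = monom 1 (d + 1) - r"
  have deg: "degree r \<le> d" using degree_mod_less[OF D(1), of "monom 1 (d + 1)"] D(2) by (auto simp: r_def)
  have dvd: "D dvd u" by (simp add: u_def r_def dvd_minus_mod)
  obtain \<mu> where \<mu>: "\<mu> > 0"
    "\<And>q R. \<lbrakk>degree q \<le> d; 1 \<le> R; wnorm R q < \<mu>\<rbrakk> \<Longrightarrow> positive_coeffs d (p + q)"
    using positive_coeffs_perturb[OF p] by blast
  define W where "W = wnorm R u + wnorm R r + 1"
  have W: "0 < W" "wnorm R u < W" "wnorm R r < W"
    using wnorm_nonneg[of R u] wnorm_nonneg[of R r] \<open>1 \<le> R\<close> by (auto simp: W_def)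
  \<comment> \<open>One scale for both demands: \<eta> r stays below \<mu>, which preserves
    positivity, and \<eta> u stays below \<epsilon>.\<close>
  define \<eta> where "\<eta> = min \<mu> \<epsilon> / W"
  have \<eta>: "\<eta> > 0" using W \<mu>(1) \<open>\<epsilon> > 0\<close> by (simp add: \<eta>_def)
  have lt: "\<eta> * w < min \<mu> \<epsilon>" if "w < W" for w
  proof -
    have "\<eta> * w < \<eta> * W" using \<eta> that by simp
    then show ?thesis using W by (simp add: \<eta>_def)
  qed
  have "wnorm R (smult (- \<eta>) r) < \<mu>"
    unfolding wnorm_smult abs_minus_cancel using lt[OF W(3)] \<eta> by simp
  then have pos: "positive_coeffs d (p + smult (- \<eta>) r)"
    using deg \<open>1 \<le> R\<close> by (intro \<mu>(2)[of _ R]) auto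
  have eq: "p + smult \<eta> u = (p + smult (- \<eta>) r) + monom \<eta> (d + 1)"
    by (simp add: u_def smult_diff_right smult_monom)
  have "positive_coeffs (d + 1) (p + smult \<eta> u)"
    unfolding positive_coeffs_def
  proof (intro conjI ballI)
    show "degree (p + smult \<eta> u) \<le> d + 1"
      unfolding eq
    proof (rule degree_add_le)
      show "degree (p + smult (- \<eta>) r) \<le> d + 1"
        using pos unfolding positive_coeffs_def by linarith
    qed (rule degree_monom_le)
    fix k assume "k \<in> {1..d + 1}"
    then consider "k \<in> {1..d}" | "k = d + 1" by force
    then show "coeff (p + smult \<eta> u) k > 0"
    proof cases
      case 1
      then have "coeff (p + smult (- \<eta>) r) k > 0" "k \<noteq> d + 1"
        using pos unfolding positive_coeffs_def by auto
      then show ?thesis unfolding eq by simp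
    next
      case 2
      then have "coeff (p + smult (- \<eta>) r) k = 0"
        using pos unfolding positive_coeffs_def by (intro coeff_eq_0) auto
      then show ?thesis unfolding eq coeff_add[of "p + smult (- \<eta>) r"] using 2 \<eta> by simp
    qed
  qed
  moreover have "wnorm R (smult \<eta> u) < \<epsilon>" using lt[OF W(2)] \<eta> by (simp add: wnorm_smult)
  ultimately show ?thesis using dvd by (intro exI[of _ "p + smult \<eta> u"]) (auto intro: dvd_smult)
qed

lemma raise_degree_by:
  assumes "positive_coeffs d p" "D \<noteq> 0" "degree D \<le> d + 1" "1 \<le> R" "\<epsilon> > 0"
  shows "\<exists>p'. positive_coeffs (d + j) p' \<and> D dvd p' - p \<and> wnorm R (p' - p) < \<epsilon>"
  using assms(5)
proof (induction j arbitrary: \<epsilon>)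
  case 0
  then show ?case using assms by (intro exI[of _ p]) auto
next
  case (Suc j)
  then have "\<epsilon> / 2 > 0" by simp
  from Suc.IH[OF this] obtain p' where p': "positive_coeffs (d + j) p'" "D dvd p' - p" "wnorm R (p' - p) < \<epsilon> / 2"
    by blast
  obtain p'' where p'': "positive_coeffs (d + j + 1) p''" "D dvd p'' - p'" "wnorm R (p'' - p') < \<epsilon> / 2"
    using raise_degree[OF p'(1) assms(2) _ assms(4) \<open>\<epsilon> / 2 > 0\<close>] assms(3) by auto
  have eq: "p'' - p = (p'' - p') + (p' - p)" by simp
  have "wnorm R (p'' - p) < \<epsilon>"
    unfolding eq using wnorm_add[of R "p'' - p'" "p' - p"] assms(4) p'(3) p''(3) by linarith
  moreover have "D dvd p'' - p" unfolding eq using p'(2) p''(2) by (rule dvd_add[rotated])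
  ultimately show ?case using p''(1) by auto
qed

section \<open>Interpolation with small coefficients\<close>

lemma eventually_abs_less_of_rat:
  assumes "(\<lambda>j. of_rat (a j) :: real) \<longlonglongrightarrow> 0" "\<epsilon> > 0"
  shows "eventually (\<lambda>j. \<bar>a j\<bar> < \<epsilon>) sequentially"
proof -
  have "eventually (\<lambda>j. \<bar>of_rat (a j) :: real\<bar> < of_rat \<epsilon>) sequentially"
    using tendstoD[OF assms(1), of "of_rat \<epsilon>"] assms(2) by (simp add: dist_real_def)
  then show ?thesis by (rule eventually_mono) (metis abs_of_rat of_rat_less)
qed

text \<open>Lagrange interpolation with every basis polynomial multiplied by D. The rational nodes
  tend to distinct reals where D does not vanish, so the denominators \<open>e j t\<close> have
  nonzero limits and the coefficients tend to 0 along with the prescribed values.\<close>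

lemma small_interpolation:
  fixes x :: "'a \<Rightarrow> real"
  assumes T: "finite T" "inj_on x T"
    and a: "\<And>t. t \<in> T \<Longrightarrow> (\<lambda>j. of_rat (a j t)) \<longlonglongrightarrow> x t"
    and D: "\<And>t. t \<in> T \<Longrightarrow> eval_rat D (x t) \<noteq> 0"
    and v: "\<And>t. t \<in> T \<Longrightarrow> (\<lambda>j. of_rat (v j t) :: real) \<longlonglongrightarrow> 0"
    and "0 \<le> R"
  obtains q where "\<And>j. D dvd q j" "\<And>j. degree (q j) \<le> degree D + card T"
    "(\<lambda>j. of_rat (wnorm R (q j)) :: real) \<longlonglongrightarrow> 0"
    "eventually (\<lambda>j. \<forall>t\<in>T. poly (q j) (a j t) = v j t) sequentially"
proof
  define e where "e j t = poly D (a j t) * (\<Prod>u\<in>T - {t}. a j t - a j u)" for j t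
  define l where "l j t = D * (\<Prod>u\<in>T - {t}. [:- a j u, 1:])" for j t
  define q where "q j = (\<Sum>t\<in>T. smult (v j t / e j t) (l j t))" for j
  have e: "(\<lambda>j. of_rat (e j t)) \<longlonglongrightarrow> eval_rat D (x t) * (\<Prod>u\<in>T - {t}. x t - x u)" if "t \<in> T" for t
    unfolding e_def of_rat_mult of_rat_prod of_rat_diff eval_rat_of_rat[symmetric]
    using a that by (intro tendsto_intros) auto
  have e_lim: "eval_rat D (x t) * (\<Prod>u\<in>T - {t}. x t - x u) \<noteq> 0" if "t \<in> T" for t
    using D T that by (auto simp: inj_on_def)
  show "D dvd q j" for j
    unfolding q_def l_def by (intro dvd_sum dvd_smult) simp
  show "degree (q j) \<le> degree D + card T" for j
    unfolding q_def
  proof (intro degree_sum_le T order_trans[OF degree_smult_le])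
    fix t assume "t \<in> T"
    have "degree (l j t) \<le> degree D + degree (\<Prod>u\<in>T - {t}. [:- a j u, 1:])"
      unfolding l_def by (rule degree_mult_le)
    also have "degree (\<Prod>u\<in>T - {t}. [:- a j u, 1:]) \<le> (\<Sum>u\<in>T - {t}. degree [:- a j u, 1:])"
      using degree_prod_sum_le[of "T - {t}" "\<lambda>u. [:- a j u, 1:]"] T by (simp add: o_def)
    also have "\<dots> \<le> card T" using T by (simp add: card_mono)
    finally show "degree (l j t) \<le> degree D + card T" by simp
  qed
  have le: "wnorm R (q j) \<le> (\<Sum>t\<in>T. \<bar>v j t\<bar> / \<bar>e j t\<bar> * (wnorm R D * (\<Prod>u\<in>T - {t}. \<bar>a j u\<bar> + R)))" for j
  proof -
    have "wnorm R (l j t) \<le> wnorm R D * (\<Prod>u\<in>T - {t}. \<bar>a j u\<bar> + R)" for t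
    proof -
      have "wnorm R (l j t) \<le> wnorm R D * wnorm R (\<Prod>u\<in>T - {t}. [:- a j u, 1:])"
        unfolding l_def by (rule wnorm_mult[OF \<open>0 \<le> R\<close>])
      also have "\<dots> \<le> wnorm R D * (\<Prod>u\<in>T - {t}. wnorm R [:- a j u, 1:])"
        by (intro mult_left_mono wnorm_prod wnorm_nonneg \<open>0 \<le> R\<close>)
      finally show ?thesis by simp
    qed
    then have "wnorm R (smult (v j t / e j t) (l j t))
        \<le> \<bar>v j t\<bar> / \<bar>e j t\<bar> * (wnorm R D * (\<Prod>u\<in>T - {t}. \<bar>a j u\<bar> + R))" for t
      unfolding wnorm_smult abs_divide by (intro mult_left_mono) auto
    then show ?thesis
      unfolding q_def using wnorm_sum[OF \<open>0 \<le> R\<close>] sum_mono by (smt (verit, best) order_trans)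
  qed
  show "(\<lambda>j. of_rat (wnorm R (q j)) :: real) \<longlonglongrightarrow> 0"
  proof (rule tendsto_sandwich[OF _ _ tendsto_const])
    let ?b = "\<lambda>j. \<Sum>t\<in>T. \<bar>v j t\<bar> / \<bar>e j t\<bar> * (wnorm R D * (\<Prod>u\<in>T - {t}. \<bar>a j u\<bar> + R))"
    let ?c = "\<lambda>t. of_rat (wnorm R D) * (\<Prod>u\<in>T - {t}. \<bar>x u\<bar> + of_rat R)"
    let ?e = "\<lambda>t. eval_rat D (x t) * (\<Prod>u\<in>T - {t}. x t - x u)"
    have "(\<lambda>j. of_rat (?b j) :: real) \<longlonglongrightarrow> (\<Sum>t\<in>T. \<bar>0\<bar> / \<bar>?e t\<bar> * ?c t)"
      unfolding of_rat_sum of_rat_mult of_rat_divide of_rat_prod of_rat_add abs_of_rat[symmetric]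
      using e_lim by (intro tendsto_intros v a e) auto
    then show "(\<lambda>j. of_rat (?b j) :: real) \<longlonglongrightarrow> 0" by simp
    show "\<forall>\<^sub>F j in sequentially. of_rat (wnorm R (q j)) \<le> (of_rat (?b j) :: real)"
      using le by (intro always_eventually allI) (simp only: of_rat_less_eq)
    show "\<forall>\<^sub>F j in sequentially. (0::real) \<le> of_rat (wnorm R (q j))"
      using wnorm_nonneg[OF \<open>0 \<le> R\<close>] by (intro always_eventually allI) simp
  qed
  \<comment> \<open>For early j a denominator may be 0, in which case the division yields 0 and the
    interpolation can fail.\<close>
  have "\<forall>\<^sub>F j in sequentially. \<forall>t\<in>T. e j t \<noteq> 0"
  proof (intro eventually_ball_finite T(1) ballI)
    fix t assume "t \<in> T"
    from tendsto_imp_eventually_ne[OF e[OF this] e_lim[OF this]]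
    show "\<forall>\<^sub>F j in sequentially. e j t \<noteq> 0" by (rule eventually_mono) auto
  qed
  then show "\<forall>\<^sub>F j in sequentially. \<forall>t\<in>T. poly (q j) (a j t) = v j t"
  proof (rule eventually_mono, intro ballI)
    fix j t assume nz: "\<forall>t\<in>T. e j t \<noteq> 0" and t: "t \<in> T"
    have other: "poly (smult (v j u / e j u) (l j u)) (a j t) = 0" if "u \<in> T - {t}" for u
    proof -
      have "(\<Prod>w\<in>T - {u}. a j t - a j w) = 0" using that t T by (intro prod_zero bexI[of _ t]) auto
      then show ?thesis by (simp add: l_def poly_prod)
    qed
    have "poly (q j) (a j t) = (\<Sum>u\<in>T. poly (smult (v j u / e j u) (l j u)) (a j t))"
      by (simp add: q_def poly_sum)
    also have "\<dots> = poly (smult (v j t / e j t) (l j t)) (a j t)"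
    proof -
      have "(\<Sum>u\<in>T - {t}. poly (smult (v j u / e j u) (l j u)) (a j t)) = 0"
        by (intro sum.neutral ballI other)
      then show ?thesis unfolding sum.remove[OF T(1) t] by (simp only: add_0_right)
    qed
    finally have "poly (q j) (a j t) = v j t / e j t * poly (l j t) (a j t)" by simp
    moreover have "poly (l j t) (a j t) = e j t" by (simp add: l_def e_def poly_prod)
    ultimately show "poly (q j) (a j t) = v j t" using nz t by simp
  qed
qed

section \<open>Making periodic points rational\<close>

lemma near_quadratic_sqpoly:
  assumes "wnorm 4 (p - [:-2, 4:]) \<le> 1/100"
  shows "near_quadratic (sqpoly p)"
proof
  fix z :: complex assume "norm z \<le> 2"
  then have "(norm z)\<^sup>2 \<le> of_rat 4" using power_mono[of "norm z" 2 2] by simp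
  then have "norm (sqpoly (p - [:-2, 4:]) z) \<le> of_rat (wnorm 4 (p - [:-2, 4:]))"
    by (rule norm_sqpoly_le)
  also have "\<dots> \<le> of_rat (1/100)" using assms by (simp only: of_rat_less_eq)
  finally show "norm (sqpoly p z - (4 * z\<^sup>2 - 2)) \<le> 1/100"
    by (simp add: sqpoly_diff of_rat_divide of_rat_minus algebra_simps)
qed (auto simp: sqpoly_minus_arg sqpoly_cnj holomorphic_sqpoly)

text \<open>Only values of p at squares of points of Y enter, so freezing these values carries the
  cycles over to later polynomials and to the limit. There is one cycle per itinerary \<sigma>; only
  the entries of c up to index n matter.\<close>

definition rational_cycles :: "nat \<Rightarrow> rat poly \<Rightarrow> rat set \<Rightarrow> bool" where
  "rational_cycles n p Y \<longleftrightarrow> (\<forall>\<sigma>::nat \<Rightarrow> bool. \<exists>c::nat \<Rightarrow> rat. c n = c 0 \<and>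
    (\<forall>k<n. c k \<in> Y \<and> \<bar>c k\<bar> < 1 \<and> poly p ((c k)\<^sup>2) = c (Suc k) \<and> (c k > 0 \<longleftrightarrow> \<sigma> k)))"

text \<open>A periodic point in \<open>\<plusminus> S\<close> cannot be moved, but then its whole orbit is rational already.\<close>

lemma rationalize_cycles:
  assumes near: "near_quadratic (sqpoly p)" and p: "positive_coeffs d p" and S: "finite S"
    and n: "n \<ge> 1" and d: "2 * card S + 2 ^ n \<le> d" and "R \<ge> 1" "\<epsilon> > 0"
  shows "\<exists>p' Y. positive_coeffs d p' \<and> vanishing S dvd p' - p \<and> wnorm R (p' - p) < \<epsilon> \<and>
    finite Y \<and> card Y \<le> 2 ^ n \<and> rational_cycles n p' Y"
proof -
  interpret near_quadratic "sqpoly p" by (rule near)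
  let ?f = "sqpoly p" and ?D = "vanishing S"
  have X: "finite (cyc n)" "card (cyc n) \<le> 2 ^ n" using finite_cyc n by blast+
  have re: "of_real (Re z) = z" if "z \<in> cyc n" for z
    using cyc_real[OF n that] by (simp add: of_real_Re)
  \<comment> \<open>Rational approximations of the periodic points, exact at the points that are
    rational already.\<close>
  define y where "y j z = (SOME r. \<bar>of_rat r - Re z\<bar> < 1 / (real j + 1) \<and> (z \<in> \<rat> \<longrightarrow> of_rat r = z))"
    for j :: nat and z
  have "\<exists>r. \<bar>of_rat r - Re z\<bar> < 1 / (real j + 1) \<and> (z \<in> \<rat> \<longrightarrow> of_rat r = z)" for j z
  proof (cases "z \<in> \<rat>")
    case True
    then obtain r where r: "z = of_rat r" by (rule Rats_cases)
    then have "Re z = of_rat r" using Re_complex_of_real[of "of_rat r"] by simp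
    then show ?thesis using r by (intro exI[of _ r]) simp
  next
    case False
    obtain r where "Re z < of_rat r" "of_rat r < Re z + 1 / (real j + 1)"
      using of_rat_dense[of "Re z" "Re z + 1 / (real j + 1)"] by auto
    then show ?thesis using False by (intro exI[of _ r]) auto
  qed
  from someI_ex[OF this]
  have y: "\<bar>of_rat (y j z) - Re z\<bar> < 1 / (real j + 1)" "z \<in> \<rat> \<Longrightarrow> of_rat (y j z) = z" for j z
    unfolding y_def by blast+
  have y_lim: "(\<lambda>j. of_rat (y j z)) \<longlonglongrightarrow> Re z" for z
  proof (rule LIMSEQ_I)
    fix r :: real assume "r > 0"
    then obtain N where N: "1 / (real N + 1) < r"
      using nat_approx_posE[of r] by (metis add.commute of_nat_Suc)
    have "norm (of_rat (y j z) - Re z) < r" if "N \<le> j" for j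
    proof -
      have "1 / (real j + 1) \<le> 1 / (real N + 1)" using that by (intro divide_left_mono) auto
      then show ?thesis using y(1)[of j z] N by simp
    qed
    then show "\<exists>N. \<forall>j\<ge>N. norm (of_rat (y j z) - Re z) < r" by blast
  qed
  define T where "T = {z \<in> cyc n. eval_rat ?D ((Re z)\<^sup>2) \<noteq> 0}"
  have T: "finite T" "card T \<le> 2 ^ n" "T \<subseteq> cyc n"
    using X card_mono[of "cyc n" T] by (auto simp: T_def)
  have inj: "inj_on (\<lambda>z. (Re z)\<^sup>2) T"
  proof (rule inj_onI)
    fix z w assume zw: "z \<in> T" "w \<in> T" "(Re z)\<^sup>2 = (Re w)\<^sup>2"
    then have cyc: "z \<in> cyc n" "w \<in> cyc n" using T(3) by blast+
    have "complex_of_real (Re z) ^ 2 = of_real (Re w) ^ 2" using zw(3) by (metis of_real_power)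
    then show "z = w" unfolding re[OF cyc(1)] re[OF cyc(2)] by (rule cyc_power2_inj[OF n cyc])
  qed
  \<comment> \<open>The change of p needed at the node for the approximations to follow the old
    dynamics. It tends to 0 because f z = p(z^2).\<close>
  define v where "v j z = y j (?f z) - poly p ((y j z)\<^sup>2)" for j z
  have v: "(\<lambda>j. of_rat (v j z) :: real) \<longlonglongrightarrow> 0" if "z \<in> cyc n" for z
  proof -
    have "complex_of_real (Re (?f z)) = of_real (eval_rat p ((Re z)\<^sup>2))"
      using re[OF f_mem_cyc[OF n that]] re[OF that] sqpoly_of_real[of p "Re z"] by simp
    then have eq: "Re (?f z) = eval_rat p ((Re z)\<^sup>2)" by (simp only: of_real_eq_iff)
    have "(\<lambda>j. of_rat (v j z) :: real) \<longlonglongrightarrow> Re (?f z) - eval_rat p ((Re z)\<^sup>2)"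
      unfolding v_def of_rat_diff eval_rat_of_rat[symmetric] of_rat_power
      by (intro tendsto_intros y_lim)
    then show ?thesis using eq by simp
  qed
  have a: "(\<lambda>j. of_rat ((y j z)\<^sup>2)) \<longlonglongrightarrow> (Re z)\<^sup>2" for z
    unfolding of_rat_power by (intro tendsto_intros y_lim)
  have D: "eval_rat ?D ((Re z)\<^sup>2) \<noteq> 0" if "z \<in> T" for z using that by (simp add: T_def)
  have vT: "(\<lambda>j. of_rat (v j z) :: real) \<longlonglongrightarrow> 0" if "z \<in> T" for z
    using v T(3) that by blast
  have "0 \<le> R" using \<open>R \<ge> 1\<close> by simp
  obtain q where q: "\<And>j. ?D dvd q j" "\<And>j. degree (q j) \<le> degree ?D + card T"
    "(\<lambda>j. of_rat (wnorm R (q j)) :: real) \<longlonglongrightarrow> 0"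
    "eventually (\<lambda>j. \<forall>z\<in>T. poly (q j) ((y j z)\<^sup>2) = v j z) sequentially"
    using small_interpolation[where a = "\<lambda>j z. (y j z)\<^sup>2" and v = v, OF T(1) inj a D vT \<open>0 \<le> R\<close>]
    by blast
  obtain \<mu> where \<mu>: "\<mu> > 0"
    "\<And>q R. \<lbrakk>degree q \<le> d; 1 \<le> R; wnorm R q < \<mu>\<rbrakk> \<Longrightarrow> positive_coeffs d (p + q)"
    using positive_coeffs_perturb[OF p] by blast
  have ev1: "\<forall>\<^sub>F j in sequentially. \<bar>wnorm R (q j)\<bar> < min \<mu> \<epsilon>"
    using \<mu>(1) \<open>\<epsilon> > 0\<close> by (intro eventually_abs_less_of_rat q(3)) simp
  \<comment> \<open>Real parts of periodic points are nonzero, so their signs, and with them the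
    itineraries, survive approximation.\<close>
  have ev2: "\<forall>\<^sub>F j in sequentially. \<forall>z\<in>cyc n. \<bar>y j z\<bar> < 1 \<and> (y j z > 0 \<longleftrightarrow> Re z > 0)"
  proof (intro eventually_ball_finite X(1) ballI)
    fix z assume "z \<in> cyc n"
    then have z: "z \<in> dom" using cyc_subset_dom[OF n] by blast
    then have lt: "\<bar>Re z\<bar> < 1" using abs_Re_le_cmod[of z] by (simp add: mem_dom_iff)
    have "\<forall>\<^sub>F j in sequentially. \<bar>of_rat (y j z) :: real\<bar> < 1"
      by (rule order_tendstoD(2)[OF tendsto_rabs[OF y_lim] lt])
    then have 1: "\<forall>\<^sub>F j in sequentially. \<bar>y j z\<bar> < 1"
      by (rule eventually_mono) (metis abs_of_rat of_rat_less_1_iff)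
    have 2: "\<forall>\<^sub>F j in sequentially. y j z > 0 \<longleftrightarrow> Re z > 0"
    proof (cases "Re z > 0")
      case True
      from order_tendstoD(1)[OF y_lim this] show ?thesis
        by (rule eventually_mono) (use True in simp)
    next
      case False
      then have "Re z < 0" using Re_nonzero[OF z] by simp
      from order_tendstoD(2)[OF y_lim this] show ?thesis
        by (rule eventually_mono) (use False in simp)
    qed
    show "\<forall>\<^sub>F j in sequentially. \<bar>y j z\<bar> < 1 \<and> (y j z > 0 \<longleftrightarrow> Re z > 0)"
      using 1 2 by (rule eventually_conj)
  qed
  obtain j where j: "\<bar>wnorm R (q j)\<bar> < min \<mu> \<epsilon>" "\<And>z. z \<in> T \<Longrightarrow> poly (q j) ((y j z)\<^sup>2) = v j z"
    "\<And>z. z \<in> cyc n \<Longrightarrow> \<bar>y j z\<bar> < 1" "\<And>z. z \<in> cyc n \<Longrightarrow> y j z > 0 \<longleftrightarrow> Re z > 0"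
    using eventually_happens'[OF sequentially_bot eventually_conj[OF ev1 eventually_conj[OF q(4) ev2]]]
    by blast
  define p' where "p' = p + q j"
  have diff: "p' - p = q j" by (simp add: p'_def)
  have "degree (q j) \<le> d"
    using q(2)[of j] T(2) d by (simp add: degree_vanishing)
  then have "positive_coeffs d p'"
    unfolding p'_def using j(1) \<open>R \<ge> 1\<close> by (intro \<mu>(2)[of _ R]) auto
  moreover have "wnorm R (p' - p) < \<epsilon>" unfolding diff using j(1) by linarith
  moreover have "?D dvd p' - p" unfolding diff by (rule q)
  moreover have "finite (y j ` cyc n)" "card (y j ` cyc n) \<le> 2 ^ n"
    using X card_image_le[of "cyc n" "y j"] by auto
  moreover have "rational_cycles n p' (y j ` cyc n)"
    unfolding rational_cycles_def
  proof
    have maps: "poly p' ((y j z)\<^sup>2) = y j (?f z)" if z: "z \<in> cyc n" for z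
    proof (cases "z \<in> T")
      case True
      then show ?thesis by (simp add: p'_def j(2) v_def)
    next
      \<comment> \<open>Here z is s or -s, so z and its image are rational: \<open>y\<close> keeps
        both exactly, and the correction vanishes at z^2.\<close>
      case False
      then obtain s where s: "s \<in> S" "(Re z)\<^sup>2 = of_rat (s\<^sup>2)"
        using z S by (auto simp: T_def eval_rat_vanishing)
      have "z\<^sup>2 = of_real (of_rat (s\<^sup>2))"
        using re[OF z] s(2) by (metis of_real_power)
      then have z2: "z\<^sup>2 = (of_rat s)\<^sup>2" by (simp add: of_rat_power)
      then have "z = of_rat s \<or> z = of_rat (- s)" by (auto simp: power2_eq_iff of_rat_minus)
      then have zy: "of_rat (y j z) = z" using y(2) Rats_of_rat by metis
      then have "of_rat ((y j z)\<^sup>2) = (of_rat (s\<^sup>2) :: complex)" using z2 by (simp add: of_rat_power)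
      then have ys: "(y j z)\<^sup>2 = s\<^sup>2" by (simp only: of_rat_eq_iff)
      then have q0: "poly (q j) ((y j z)\<^sup>2) = 0" using vanishing_dvdD(1)[OF q(1) S s(1)] by simp
      have fz: "?f z = of_rat (poly p ((y j z)\<^sup>2))" using sqpoly_of_rat[of p "y j z"] zy by simp
      then have "of_rat (y j (?f z)) = ?f z" by (intro y(2)) simp
      then have "y j (?f z) = poly p ((y j z)\<^sup>2)" using fz by (metis of_rat_eq_iff)
      then show ?thesis using q0 by (simp add: p'_def)
    qed
    fix \<sigma> :: "nat \<Rightarrow> bool"
    obtain z where z: "z \<in> cyc n" "\<And>k. k < n \<Longrightarrow> Re ((?f ^^ k) z) > 0 \<longleftrightarrow> \<sigma> k"
      using cyc_exists by blast
    have mem: "(?f ^^ k) z \<in> cyc n" for k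
      using z(1) by (induction k) (auto intro: f_mem_cyc n)
    have "(?f ^^ n) z = z" using z(1) by (simp add: cyc_def)
    then show "\<exists>c::nat \<Rightarrow> rat. c n = c 0 \<and> (\<forall>k<n. c k \<in> y j ` cyc n \<and> \<bar>c k\<bar> < 1 \<and>
        poly p' ((c k)\<^sup>2) = c (Suc k) \<and> (c k > 0 \<longleftrightarrow> \<sigma> k))"
      using maps[OF mem] j(3)[OF mem] j(4)[OF mem] z(2) mem
      by (intro exI[of _ "\<lambda>k. y j ((?f ^^ k) z)"]) simp
  qed
  ultimately show ?thesis by blast
qed

section \<open>The limit map\<close>

text \<open>\<theta> is the budget for the future: all later corrections total at most 2 \<theta>,
  against coefficients of at least 4 \<theta> and a remaining tolerance of 2 \<theta>. The bound n
  <= d lets the range of positive coefficients grow without end.\<close>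

definition stage :: "nat \<Rightarrow> rat poly \<times> nat \<times> rat set \<times> rat \<Rightarrow> bool" where
  "stage n = (\<lambda>(p, d, S, \<theta>). finite S \<and> 2 * card S \<le> d \<and> n \<le> d \<and> degree p \<le> d \<and>
    \<theta> > 0 \<and> (\<forall>k\<in>{1..d}. 4 * \<theta> \<le> coeff p k) \<and> wnorm 4 (p - [:-2, 4:]) + 2 * \<theta> \<le> 1/100)"

text \<open>The weight n + 4 tends to infinity, which gives convergence on every disc, while
  \<open>from_nat n\<close> runs through all rationals. Periods start at 1, hence
  \<open>Suc n\<close>.\<close>

definition stage_succ ::
    "nat \<Rightarrow> rat poly \<times> nat \<times> rat set \<times> rat \<Rightarrow> rat poly \<times> nat \<times> rat set \<times> rat \<Rightarrow> bool" where
  "stage_succ n = (\<lambda>(p, d, S, \<theta>) (p', d', S', \<theta>'). vanishing S dvd p' - p \<and>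
    wnorm (of_nat n + 4) (p' - p) \<le> \<theta> \<and> \<theta>' \<le> \<theta> / 2 \<and> S \<subseteq> S' \<and> from_nat n \<in> S' \<and>
    rational_cycles (Suc n) p' S')"

lemma rational_cycles_mono:
  assumes "rational_cycles n p Y" "Y \<subseteq> Z"
  shows "rational_cycles n p Z"
  unfolding rational_cycles_def
proof
  fix \<sigma> :: "nat \<Rightarrow> bool"
  obtain c where c: "c n = c 0" "\<forall>k<n. c k \<in> Y \<and> \<bar>c k\<bar> < 1 \<and> poly p ((c k)\<^sup>2) = c (Suc k) \<and>
      (c k > 0 \<longleftrightarrow> \<sigma> k)"
    using assms(1)[unfolded rational_cycles_def, THEN spec[of _ \<sigma>]] by (elim exE conjE)
  have "c k \<in> Z \<and> \<bar>c k\<bar> < 1 \<and> poly p ((c k)\<^sup>2) = c (Suc k) \<and> (c k > 0 \<longleftrightarrow> \<sigma> k)" if "k < n" for k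
    using c(2)[rule_format, OF that] subsetD[OF assms(2), of "c k"] by (intro conjI) simp_all
  with c(1) show "\<exists>c. c n = c 0 \<and> (\<forall>k<n. c k \<in> Z \<and> \<bar>c k\<bar> < 1 \<and> poly p ((c k)\<^sup>2) = c (Suc k) \<and>
      (c k > 0 \<longleftrightarrow> \<sigma> k))"
    by (intro exI[of _ c]) simp
qed

text \<open>There is no deviation from the quadratic polynomial yet, so \<theta> = 1/200 spends the
  whole tolerance 1/100.\<close>

lemma stage_0: "stage 0 ([:-2, 4:], 1, {}, 1/200)"
  by (auto simp: stage_def)

lemma stage_step:
  assumes "stage n st"
  shows "\<exists>st'. stage (Suc n) st' \<and> stage_succ n st st'"
proof -
  obtain p d S \<theta> where st: "st = (p, d, S, \<theta>)" by (cases st)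
  have S: "finite S" "2 * card S \<le> d" and deg: "degree p \<le> d" and \<theta>: "\<theta> > 0"
    and coeffs: "\<And>k. k \<in> {1..d} \<Longrightarrow> 4 * \<theta> \<le> coeff p k"
    and near: "wnorm 4 (p - [:-2, 4:]) + 2 * \<theta> \<le> 1/100"
    using assms unfolding st stage_def by auto
  define R :: rat where "R = of_nat n + 4"
  have R: "1 \<le> R" "4 \<le> R" by (auto simp: R_def)
  have W4: "wnorm 4 q \<le> wnorm R q" for q by (rule wnorm_mono) (use R in auto)
  \<comment> \<open>Room for two degrees for each of the at most 2^(n+1) + 1 newly frozen points,
    which also covers the interpolation, and for n + 1 <= e.\<close>
  define e where "e = d + (2 * 2 ^ Suc n + 2 + n)"
  have pos: "positive_coeffs d p"
    unfolding positive_coeffs_def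
  proof (intro conjI ballI deg)
    show "coeff p k > 0" if "k \<in> {1..d}" for k using coeffs[OF that] \<theta> by linarith
  qed
  have half: "\<theta> / 2 > 0" using \<theta> by simp
  have degD: "degree (vanishing S) \<le> d + 1" using S(2) by (simp add: degree_vanishing)
  \<comment> \<open>Half of \<theta> goes to raising the degree and half to moving the cycles. The
    degree comes first, to make room for the interpolation.\<close>
  obtain p1 where p1: "positive_coeffs e p1" "vanishing S dvd p1 - p" "wnorm R (p1 - p) < \<theta> / 2"
    using raise_degree_by[OF pos vanishing_nonzero[OF S(1)] degD R(1) half] unfolding e_def by blast
  have triangle: "wnorm 4 (q - [:-2, 4:]) \<le> wnorm 4 (q - p) + wnorm 4 (p - [:-2, 4:])" for q
  proof -
    have "q - [:-2, 4:] = (q - p) + (p - [:-2, 4:])" by (simp only: diff_add_cancel add_diff_eq)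
    then show ?thesis using wnorm_add[of 4 "q - p" "p - [:-2, 4:]"] by (simp only:)
  qed
  have near1: "near_quadratic (sqpoly p1)"
    using triangle[of p1] W4[of "p1 - p"] p1(3) near \<theta> by (intro near_quadratic_sqpoly) linarith
  have card: "2 * card S + 2 ^ Suc n \<le> e" using S(2) by (simp add: e_def)
  obtain p' Y where p': "positive_coeffs e p'" "vanishing S dvd p' - p1"
      "wnorm R (p' - p1) < \<theta> / 2"
    and Y: "finite Y" "card Y \<le> 2 ^ Suc n" "rational_cycles (Suc n) p' Y"
    using rationalize_cycles[OF near1 p1(1) S(1) _ card R(1) half] by auto
  define S' where "S' = insert (from_nat n) (S \<union> Y)"
  obtain \<mu> where \<mu>: "\<mu> > 0" "\<And>k. k \<in> {1..e} \<Longrightarrow> \<mu> \<le> coeff p' k"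
    using positive_coeffs_lower_bound[OF p'(1)] by blast
  define \<theta>' where "\<theta>' = min (\<theta> / 2) (\<mu> / 4)"
  have \<theta>': "\<theta>' > 0" "\<theta>' \<le> \<theta> / 2" "4 * \<theta>' \<le> \<mu>" using \<theta> \<mu> by (auto simp: \<theta>'_def)
  have eq: "p' - p = (p' - p1) + (p1 - p)" by simp
  have W: "wnorm R (p' - p) \<le> \<theta>"
    unfolding eq using wnorm_add[of R "p' - p1" "p1 - p"] R p1(3) p'(3) by linarith
  have dvd: "vanishing S dvd p' - p" unfolding eq using p1(2) p'(2) by (rule dvd_add[rotated])
  have "card S' \<le> Suc (card (S \<union> Y))"
    unfolding S'_def using S(1) Y(1) by (simp add: card_insert_if)
  then have "card S' \<le> Suc (card S + card Y)" using card_Un_le[of S Y] by linarith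
  then have "2 * card S' \<le> e" using S(2) Y(2) by (simp add: e_def)
  moreover have "wnorm 4 (p' - [:-2, 4:]) + 2 * \<theta>' \<le> 1/100"
    using triangle[of p'] W4[of "p' - p"] W near \<theta>'(2) by linarith
  moreover have "degree p' \<le> e" using p'(1) by (simp add: positive_coeffs_def)
  moreover have "\<forall>k\<in>{1..e}. 4 * \<theta>' \<le> coeff p' k"
    by (intro ballI order_trans[OF \<theta>'(3) \<mu>(2)])
  moreover have "finite S'" using S Y by (simp add: S'_def)
  moreover have "Suc n \<le> e" by (simp add: e_def)
  ultimately have "stage (Suc n) (p', e, S', \<theta>')"
    unfolding stage_def prod.case using \<theta>'(1) by (intro conjI)
  moreover have "rational_cycles (Suc n) p' S'"
    using Y(3) by (rule rational_cycles_mono) (auto simp: S'_def)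
  then have "stage_succ n st (p', e, S', \<theta>')"
    unfolding stage_succ_def st prod.case using dvd W[unfolded R_def] \<theta>'(2)
    by (intro conjI) (auto simp: S'_def)
  ultimately show ?thesis by blast
qed

section \<open>Convergence of a sequence of stages\<close>

locale stages =
  fixes p :: "nat \<Rightarrow> rat poly" and d :: "nat \<Rightarrow> nat" and S :: "nat \<Rightarrow> rat set" and \<theta> :: "nat \<Rightarrow> rat"
  assumes stage: "stage n (p n, d n, S n, \<theta> n)"
    and stage_succ: "stage_succ n (p n, d n, S n, \<theta> n) (p (Suc n), d (Suc n), S (Suc n), \<theta> (Suc n))"
begin

lemma \<theta>_pos: "\<theta> n > 0" using stage[of n] by (simp add: stage_def)

lemma finite_S: "finite (S n)" using stage[of n] by (simp add: stage_def)

text \<open>Each step spends at most \<theta> m, and the halving of \<theta> frees as much, so the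
  distance plus 2 \<theta> m never exceeds 2 \<theta> n.\<close>

lemma wnorm_diff_le:
  assumes "0 \<le> R" "R \<le> of_nat n + 4" "n \<le> m"
  shows "wnorm R (p m - p n) \<le> 2 * \<theta> n"
proof -
  have "wnorm R (p m - p n) + 2 * \<theta> m \<le> 2 * \<theta> n"
    using assms(3)
  proof (induction m rule: dec_induct)
    case (step m)
    have "of_nat n \<le> (of_nat m :: rat)" using step(1) by simp
    then have "R \<le> of_nat m + 4" using assms(2) by linarith
    then have "wnorm R (p (Suc m) - p m) \<le> \<theta> m"
      using stage_succ[of m] wnorm_mono[OF assms(1)] order_trans unfolding stage_succ_def by blast
    moreover have "\<theta> (Suc m) \<le> \<theta> m / 2" using stage_succ[of m] by (simp add: stage_succ_def)
    moreover have "wnorm R (p (Suc m) - p n) \<le> wnorm R (p (Suc m) - p m) + wnorm R (p m - p n)"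
      using wnorm_add[OF assms(1), of "p (Suc m) - p m" "p m - p n"] by simp
    ultimately show ?case using step(3) by linarith
  qed simp
  then show ?thesis using \<theta>_pos[of m] by linarith
qed

lemma \<theta>_le: "\<theta> n \<le> (1/2) ^ n"
proof (induction n)
  case 0
  have "0 \<le> wnorm 4 (p 0 - [:-2, 4:])" by (rule wnorm_nonneg) simp
  then show ?case using stage[of 0] by (simp add: stage_def)
next
  case (Suc n)
  then show ?case using stage_succ[of n] by (simp add: stage_succ_def)
qed

lemma sqpoly_diff_le:
  assumes "(norm z)\<^sup>2 \<le> real n + 4" "n \<le> m"
  shows "norm (sqpoly (p m) z - sqpoly (p n) z) \<le> 2 * (1/2) ^ n"
proof -
  have "(norm z)\<^sup>2 \<le> of_rat (of_nat n + 4)" using assms(1) by (simp add: of_rat_add)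
  then have "norm (sqpoly (p m - p n) z) \<le> of_rat (wnorm (of_nat n + 4) (p m - p n))"
    by (rule norm_sqpoly_le)
  also have "\<dots> \<le> of_rat (2 * (1/2) ^ n)"
    unfolding of_rat_less_eq using wnorm_diff_le[of "of_nat n + 4" n m] \<theta>_le[of n] assms(2) by simp
  finally show ?thesis by (simp add: sqpoly_diff of_rat_mult of_rat_power of_rat_divide)
qed

definition f :: "complex \<Rightarrow> complex" where
  "f z = lim (\<lambda>n. sqpoly (p n) z)"

lemma uniform_limit_f: "uniform_limit (cball 0 r) (\<lambda>n. sqpoly (p n)) f sequentially"
proof -
  have "uniformly_Cauchy_on (cball 0 r) (\<lambda>n. sqpoly (p n))"
  proof (rule uniformly_Cauchy_onI')
    fix \<epsilon> :: real assume "\<epsilon> > 0"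
    then obtain N where N: "(1/2) ^ N < \<epsilon> / 2" using real_arch_pow_inv[of "\<epsilon> / 2" "1/2"] by auto
    obtain M where M: "r\<^sup>2 \<le> real M" using real_arch_simple by blast
    show "\<exists>M. \<forall>x\<in>cball 0 r. \<forall>m\<ge>M. \<forall>n>m. dist (sqpoly (p m) x) (sqpoly (p n) x) < \<epsilon>"
    proof (intro exI ballI allI impI)
      fix x :: complex and m n
      assume x: "x \<in> cball 0 r" and m: "max M N \<le> m" and n: "m < n"
      have "(norm x)\<^sup>2 \<le> r\<^sup>2" using x by (intro power_mono) auto
      then have "norm (sqpoly (p n) x - sqpoly (p m) x) \<le> 2 * (1/2) ^ m"
        using M m n by (intro sqpoly_diff_le) auto
      also have "\<dots> \<le> 2 * (1/2) ^ N"
        using m by (intro mult_left_mono power_decreasing) auto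
      also have "\<dots> < \<epsilon>" using N by simp
      finally show "dist (sqpoly (p m) x) (sqpoly (p n) x) < \<epsilon>" by (simp add: dist_norm norm_minus_commute)
    qed
  qed
  then show ?thesis
    using Cauchy_uniformly_convergent uniformly_convergent_uniform_limit_iff
    unfolding f_def by blast
qed

lemma LIMSEQ_f: "(\<lambda>n. sqpoly (p n) z) \<longlonglongrightarrow> f z"
  using tendsto_uniform_limitI[OF uniform_limit_f[of "norm z"], of z] by simp

lemma derivative_f:
  "(f has_field_derivative deriv f z) (at z)"
  "(\<lambda>n. 2 * z * sqpoly (pderiv (p n)) z) \<longlonglongrightarrow> deriv f z"
proof -
  have "\<exists>g'. \<forall>x\<in>UNIV. (f has_field_derivative g' x) (at x) \<and>
      (\<lambda>n. 2 * x * sqpoly (pderiv (p n)) x) \<longlonglongrightarrow> g' x"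
  proof (rule has_complex_derivative_uniform_sequence)
    fix x :: complex
    have "cball x 1 \<subseteq> cball 0 (norm x + 1)"
      by (simp add: cball_subset_cball_iff)
    then show "\<exists>r>0. cball x r \<subseteq> UNIV \<and> uniform_limit (cball x r) (\<lambda>n. sqpoly (p n)) f sequentially"
      using uniform_limit_on_subset[OF uniform_limit_f] by (intro exI[of _ 1]) auto
  qed (auto intro: sqpoly_has_field_derivative)
  then obtain g' where g': "(f has_field_derivative g' x) (at x)"
    "(\<lambda>n. 2 * x * sqpoly (pderiv (p n)) x) \<longlonglongrightarrow> g' x" for x
    by blast
  then show "(f has_field_derivative deriv f z) (at z)"
    "(\<lambda>n. 2 * z * sqpoly (pderiv (p n)) z) \<longlonglongrightarrow> deriv f z"
    using DERIV_imp_deriv[OF g'(1)[of z]] by auto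
qed

lemma holomorphic_f: "f holomorphic_on A"
  using derivative_f(1) by (meson field_differentiable_at_within field_differentiable_def holomorphic_onI)

sublocale near_quadratic f
proof
  show "f (- z) = f z" for z by (simp add: f_def sqpoly_minus_arg)
  show "f (cnj z) = cnj (f z)" for z
    using LIMSEQ_unique[OF LIMSEQ_f[of "cnj z"]] tendsto_cnj[OF LIMSEQ_f[of z]]
    by (simp add: sqpoly_cnj)
  show "norm (f z - (4 * z\<^sup>2 - 2)) \<le> 1/100" if "norm z \<le> 2" for z
  proof (rule LIMSEQ_le_const2)
    show "(\<lambda>n. norm (sqpoly (p n) z - (4 * z\<^sup>2 - 2))) \<longlonglongrightarrow> norm (f z - (4 * z\<^sup>2 - 2))"
      by (intro tendsto_intros LIMSEQ_f)
    have "near_quadratic (sqpoly (p n))" for n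
    proof (rule near_quadratic_sqpoly)
      show "wnorm 4 (p n - [:-2, 4:]) \<le> 1/100"
        using stage[of n] \<theta>_pos[of n] unfolding stage_def by simp
    qed
    then show "\<exists>N. \<forall>n\<ge>N. norm (sqpoly (p n) z - (4 * z\<^sup>2 - 2)) \<le> 1/100"
      using that near_quadratic.near by blast
  qed
qed (rule holomorphic_f)

section \<open>Positive coefficients: convexity and transcendence\<close>

lemma coeff_lower_bound:
  assumes "1 \<le> n" "n \<le> m"
  shows "2 * \<theta> n \<le> coeff (p m) n"
proof -
  \<comment> \<open>Stage n covers index n because n <= d n; all later corrections together take
    away at most 2 \<theta> n.\<close>
  have "4 * \<theta> n \<le> coeff (p n) n" using stage[of n] assms(1) by (simp add: stage_def)
  moreover have "\<bar>coeff (p m - p n) n\<bar> \<le> 2 * \<theta> n"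
    using abs_coeff_le_wnorm[of 1 "p m - p n" n] wnorm_diff_le[of 1 n m] assms(2) by simp
  ultimately show ?thesis by simp
qed

lemma Re_sqpoly: "Re (sqpoly (p n) (of_real x)) = (\<Sum>k\<le>d n. of_rat (coeff (p n) k) * x ^ (2 * k))"
proof -
  have "degree (p n) \<le> d n" using stage[of n] by (simp add: stage_def)
  then show ?thesis by (simp only: sqpoly_eq_sum Re_complex_of_real)
qed

lemma coeff_nonneg: "k \<in> {1..d n} \<Longrightarrow> 0 \<le> coeff (p n) k"
  using stage[of n] \<theta>_pos[of n] unfolding stage_def by force

text \<open>Each approximant is a constant plus a nonnegative combination of even powers, and
  convexity passes to pointwise limits.\<close>

lemma convex_on_f: "convex_on UNIV (\<lambda>x::real. Re (f (of_real x)))"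
proof -
  have conv: "convex_on UNIV (\<lambda>x. Re (sqpoly (p n) (of_real x)))" for n
  proof -
    have summand: "convex_on UNIV (\<lambda>x::real. of_rat (coeff (p n) k) * x ^ (2 * k))" if "k \<le> d n" for k
    proof (cases "k = 0")
      case True
      then show ?thesis by (simp add: convex_on_const)
    next
      case False
      then show ?thesis using coeff_nonneg[of k n] that
        by (intro convex_on_cmul convex_power_even) auto
    qed
    have "convex_on UNIV (\<lambda>x::real. \<Sum>k\<in>A. of_rat (coeff (p n) k) * x ^ (2 * k))"
      if "finite A" "A \<subseteq> {..d n}" for A
      using that
    proof (induction A rule: finite_induct)
      case (insert k A)
      then have "convex_on UNIV (\<lambda>x::real. of_rat (coeff (p n) k) * x ^ (2 * k)
          + (\<Sum>k\<in>A. of_rat (coeff (p n) k) * x ^ (2 * k)))"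
        by (intro convex_on_add summand) auto
      then show ?case using insert(1,2) by simp
    qed (simp add: convex_on_const)
    from this[of "{..d n}"] show ?thesis unfolding Re_sqpoly by simp
  qed
  show ?thesis
  proof (rule convex_onI)
    fix t x y :: real assume t: "0 < t" "t < 1"
    let ?z = "(1 - t) *\<^sub>R x + t *\<^sub>R y"
    have lim: "(\<lambda>n. Re (sqpoly (p n) (of_real x))) \<longlonglongrightarrow> Re (f (of_real x))" for x
      by (intro tendsto_intros LIMSEQ_f)
    show "Re (f (of_real ?z)) \<le> (1 - t) * Re (f (of_real x)) + t * Re (f (of_real y))"
    proof (rule LIMSEQ_le[OF lim])
      show "(\<lambda>n. (1 - t) * Re (sqpoly (p n) (of_real x)) + t * Re (sqpoly (p n) (of_real y)))
          \<longlonglongrightarrow> (1 - t) * Re (f (of_real x)) + t * Re (f (of_real y))"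
        by (intro tendsto_intros lim)
      have "Re (sqpoly (p n) (of_real ?z))
          \<le> (1 - t) * Re (sqpoly (p n) (of_real x)) + t * Re (sqpoly (p n) (of_real y))" for n
        using t by (intro convex_onD[OF conv]) auto
      then show "\<exists>N. \<forall>n\<ge>N. Re (sqpoly (p n) (of_real ?z))
          \<le> (1 - t) * Re (sqpoly (p n) (of_real x)) + t * Re (sqpoly (p n) (of_real y))"
        by blast
    qed
  qed simp
qed

text \<open>Of the nonnegative terms only the one of index n is kept; -3 is a crude bound for the
  constant coefficient, which is within 1/100 of -2. As n is arbitrary, f outgrows every polynomial
  on the positive axis.\<close>

lemma f_lower_bound:
  assumes "1 \<le> n" "0 \<le> x"
  shows "2 * of_rat (\<theta> n) * x ^ (2 * n) - 3 \<le> Re (f (of_real x))"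
proof (rule LIMSEQ_le_const)
  show "(\<lambda>m. Re (sqpoly (p m) (of_real x))) \<longlonglongrightarrow> Re (f (of_real x))"
    by (intro tendsto_intros LIMSEQ_f)
  have "2 * of_rat (\<theta> n) * x ^ (2 * n) - 3 \<le> Re (sqpoly (p m) (of_real x))" if m: "n \<le> m" for m
  proof -
    have "\<bar>coeff (p m - [:-2, 4:]) 0\<bar> \<le> 1/100"
      using abs_coeff_le_wnorm[of 4 "p m - [:-2, 4:]" 0] stage[of m] \<theta>_pos[of m] by (simp add: stage_def)
    then have "\<bar>coeff (p m) 0 + 2\<bar> \<le> 1/100" by simp
    then have "- 3 \<le> coeff (p m) 0" unfolding abs_le_iff by linarith
    then have "of_rat (- 3) \<le> (of_rat (coeff (p m) 0) :: real)" by (simp only: of_rat_less_eq)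
    then have c0: "- 3 \<le> (of_rat (coeff (p m) 0) :: real)" by simp
    have "of_rat (2 * \<theta> n) \<le> (of_rat (coeff (p m) n) :: real)"
      unfolding of_rat_less_eq by (rule coeff_lower_bound[OF assms(1) m])
    then have cn: "2 * of_rat (\<theta> n) * x ^ (2 * n) \<le> of_rat (coeff (p m) n) * x ^ (2 * n)"
      using assms(2) by (intro mult_right_mono) (auto simp: of_rat_mult)
    have "m \<le> d m" using stage[of m] by (simp add: stage_def)
    then have "(\<Sum>k\<in>{0, n}. of_rat (coeff (p m) k) * x ^ (2 * k))
        \<le> (\<Sum>k\<le>d m. of_rat (coeff (p m) k) * x ^ (2 * k))"
      using assms m coeff_nonneg[of _ m] by (intro sum_mono2) auto
    then show ?thesis unfolding Re_sqpoly using c0 cn assms(1) by simp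
  qed
  then show "\<exists>N. \<forall>m\<ge>N. 2 * of_rat (\<theta> n) * x ^ (2 * n) - 3 \<le> Re (sqpoly (p m) (of_real x))"
    by blast
qed

lemma not_polynomial: "\<not> (\<exists>P :: complex poly. \<forall>z. f z = poly P z)"
proof
  assume "\<exists>P :: complex poly. \<forall>z. f z = poly P z"
  then obtain P :: "complex poly" where P: "\<And>z. f z = poly P z" by blast
  define n where "n = Suc (degree P)"
  define C where "C = (\<Sum>i\<le>degree P. norm (coeff P i))"
  define t :: real where "t = of_rat (\<theta> n)"
  have t: "t > 0" using \<theta>_pos by (simp add: t_def)
  have C: "C \<ge> 0" unfolding C_def by (intro sum_nonneg) simp
  \<comment> \<open>Then t x = C + 3 + t exceeds C + 3, the bound on t x that growth of order
    \<open>degree P\<close> would impose.\<close>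
  define x where "x = (C + 3) / t + 1"
  have x: "1 \<le> x" using C t by (simp add: x_def)
  have "norm (poly P (of_real x)) \<le> (\<Sum>i\<le>degree P. norm (coeff P i * of_real x ^ i))"
    unfolding poly_altdef by (rule norm_sum)
  also have "\<dots> \<le> (\<Sum>i\<le>degree P. norm (coeff P i) * x ^ degree P)"
    using x by (intro sum_mono) (auto simp: norm_mult norm_power intro!: mult_left_mono power_increasing)
  also have "\<dots> = C * x ^ degree P" by (simp add: C_def sum_distrib_right)
  finally have "Re (f (of_real x)) \<le> C * x ^ degree P"
    unfolding P using complex_Re_le_cmod order_trans by blast
  moreover have "t * x ^ (2 * n) - 3 \<le> Re (f (of_real x))"
  proof -
    have "0 \<le> t * x ^ (2 * n)" using t x by simp
    then show ?thesis using f_lower_bound[of n x] x by (simp add: n_def t_def)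
  qed
  moreover have "t * (x * x ^ degree P) \<le> t * x ^ (2 * n)"
    unfolding power_Suc[symmetric] using t x
    by (intro mult_left_mono power_increasing) (auto simp: n_def)
  moreover have "3 \<le> 3 * x ^ degree P" using one_le_power[OF x, of "degree P"] by simp
  ultimately have "t * x * x ^ degree P \<le> (C + 3) * x ^ degree P" by (simp add: algebra_simps)
  then have "t * x \<le> C + 3" using x by (simp add: mult_le_cancel_right)
  moreover have "t * x = C + 3 + t" using t by (simp add: x_def field_simps)
  ultimately show False using t by simp
qed

section \<open>Rationality of values, cycles and multipliers\<close>

lemma S_mono: "n \<le> m \<Longrightarrow> S n \<subseteq> S m"
  by (induction m rule: dec_induct) (use stage_succ in \<open>auto simp: stage_succ_def\<close>)

lemma vanishing_dvd_diff:
  assumes "n \<le> m"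
  shows "vanishing (S n) dvd p m - p n"
  using assms
proof (induction m rule: dec_induct)
  case (step m)
  have "vanishing (S n) dvd p (Suc m) - p m"
    using vanishing_mono[OF finite_S S_mono[OF step(1)]] stage_succ[of m] dvd_trans
    unfolding stage_succ_def by blast
  then have "vanishing (S n) dvd (p (Suc m) - p m) + (p m - p n)"
    using step(3) by (rule dvd_add)
  then show ?case by simp
qed simp

text \<open>From stage n on all corrections vanish doubly at s^2, so the approximating values and
  derivatives at s form eventually constant sequences.\<close>

lemma f_of_rat:
  assumes "s \<in> S n"
  shows "f (of_rat s) = of_rat (poly (p n) (s\<^sup>2))" "deriv f (of_rat s) \<in> \<rat>"
proof -
  have vanish: "poly (p m) (s\<^sup>2) = poly (p n) (s\<^sup>2)"
    "poly (pderiv (p m)) (s\<^sup>2) = poly (pderiv (p n)) (s\<^sup>2)" if "n \<le> m" for m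
    using vanishing_dvdD[OF vanishing_dvd_diff[OF that] finite_S assms] by (simp_all add: pderiv_diff)
  have "\<forall>\<^sub>F m in sequentially. sqpoly (p m) (of_rat s) = of_rat (poly (p n) (s\<^sup>2))"
    using eventually_ge_at_top[of n]
    by (rule eventually_mono) (metis sqpoly_of_rat vanish(1))
  then show "f (of_rat s) = of_rat (poly (p n) (s\<^sup>2))"
    by (rule LIMSEQ_unique[OF LIMSEQ_f tendsto_eventually])
  have "\<forall>\<^sub>F m in sequentially. 2 * of_rat s * sqpoly (pderiv (p m)) (of_rat s)
      = 2 * of_rat s * of_rat (poly (pderiv (p n)) (s\<^sup>2))"
    using eventually_ge_at_top[of n]
    by (rule eventually_mono) (metis sqpoly_of_rat vanish(2))
  then have "deriv f (of_rat s) = 2 * of_rat s * of_rat (poly (pderiv (p n)) (s\<^sup>2))"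
    by (rule LIMSEQ_unique[OF derivative_f(2) tendsto_eventually])
  then show "deriv f (of_rat s) \<in> \<rat>" by simp
qed

lemma f_Rats: "f ` \<rat> \<subseteq> \<rat>"
proof
  fix w assume "w \<in> f ` \<rat>"
  then obtain r where r: "w = f (of_rat r)" by (auto elim: Rats_cases)
  \<comment> \<open>Step \<open>to_nat r\<close> freezes the value at r.\<close>
  have "r \<in> S (Suc (to_nat r))"
    using stage_succ[of "to_nat r"] by (simp add: stage_succ_def)
  then show "w \<in> \<rat>" using f_of_rat(1) r by simp
qed

lemma cyc_rational:
  assumes "n \<ge> 1" "z \<in> cyc n"
  shows "\<exists>s\<in>S n. z = of_rat s"
proof -
  obtain m where m: "n = Suc m" using assms(1) by (cases n) auto
  have "rational_cycles n (p n) (S n)"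
    using stage_succ[of m] by (simp add: stage_succ_def m)
  from this[unfolded rational_cycles_def, THEN spec[of _ "\<lambda>k. Re ((f ^^ k) z) > 0"]]
  obtain c where c0: "c n = c 0"
    and c_all: "\<forall>k<n. c k \<in> S n \<and> \<bar>c k\<bar> < 1 \<and> poly (p n) ((c k)\<^sup>2) = c (Suc k) \<and>
      (c k > 0 \<longleftrightarrow> Re ((f ^^ k) z) > 0)"
    by (elim exE conjE)
  have c: "c k \<in> S n" "\<bar>c k\<bar> < 1" "poly (p n) ((c k)\<^sup>2) = c (Suc k)"
    "c k > 0 \<longleftrightarrow> Re ((f ^^ k) z) > 0" if "k < n" for k
    using c_all that by blast+
  have step: "f (of_rat (c k)) = of_rat (c (Suc k))" if "k < n" for k
    using f_of_rat(1)[OF c(1)[OF that]] unfolding c(3)[OF that] .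
  have it: "(f ^^ k) (of_rat (c 0)) = of_rat (c k)" if "k \<le> n" for k
    using that by (induction k) (simp_all add: step)
  have lt: "norm (of_rat (c k) :: complex) < 1" if "k \<le> n" for k
  proof -
    have "\<bar>c k\<bar> < 1"
    proof (cases "k = n")
      case True
      then show ?thesis using c(2)[of 0] c0 assms(1) by simp
    next
      case False
      then show ?thesis using c(2)[of k] that by simp
    qed
    then show ?thesis by (simp only: norm_of_rat_complex of_rat_less_1_iff)
  qed
  have "of_rat (c k) \<in> dom" if "k < n" for k
    unfolding mem_dom_iff step[OF that] using lt that by simp
  then have cyc: "of_rat (c 0) \<in> cyc n"
    unfolding cyc_def using it c0 by simp
  have sgn: "Re (of_rat r) > 0 \<longleftrightarrow> r > 0" for r
    using Re_complex_of_real[of "of_rat r"] by simp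
  have "z = of_rat (c 0)"
  proof (rule cyc_eqI[OF assms cyc])
    fix k assume "k < n"
    then show "Re ((f ^^ k) z) > 0 \<longleftrightarrow> Re ((f ^^ k) (of_rat (c 0))) > 0"
      unfolding it[OF less_imp_le[OF \<open>k < n\<close>]] sgn by (simp only: c(4))
  qed
  then show ?thesis using c(1)[of 0] assms(1) by (intro bexI[of _ "c 0"]) simp_all
qed

text \<open>By the chain rule the derivative is a product of values of \<open>deriv f\<close> along
  the orbit, which consists of frozen rational points.\<close>

lemma cyc_multiplier_rational:
  assumes "n \<ge> 1" "z \<in> cyc n"
  shows "deriv (f ^^ k) z \<in> \<rat>"
proof -
  have cyc: "(f ^^ k) z \<in> cyc n" for k
    using assms by (induction k) (simp_all add: f_mem_cyc)
  have "\<exists>D\<in>\<rat>. ((f ^^ k) has_field_derivative D) (at z)"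
  proof (induction k)
    case 0
    have "((\<lambda>x. x) has_field_derivative 1) (at z)" by (rule DERIV_ident)
    then show ?case by (intro bexI[of _ 1]) (simp_all add: id_def)
  next
    case (Suc k)
    then obtain D where D: "D \<in> \<rat>" "((f ^^ k) has_field_derivative D) (at z)" by blast
    obtain s where "s \<in> S n" "(f ^^ k) z = of_rat s" using cyc_rational[OF assms(1) cyc] by blast
    then have "deriv f ((f ^^ k) z) * D \<in> \<rat>" using f_of_rat(2) D(1) by simp
    moreover have "((f ^^ Suc k) has_field_derivative deriv f ((f ^^ k) z) * D) (at z)"
      using DERIV_chain[OF derivative_f(1) D(2)] by simp
    ultimately show ?case by (rule bexI[rotated])
  qed
  then obtain D where D: "D \<in> \<rat>" "((f ^^ k) has_field_derivative D) (at z)" by blast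
  show ?thesis unfolding DERIV_imp_deriv[OF D(2)] by (rule D(1))
qed

end

theorem theorem1p7:
  shows "\<exists>f :: complex \<Rightarrow> complex.
    f holomorphic_on UNIV \<and> real_map f \<and> even_map f \<and> transcendental_entire f \<and>
    convex_on UNIV (\<lambda>x::real. Re (f (complex_of_real x))) \<and>
    f ` \<rat> \<subseteq> \<rat> \<and>
    (let U = {z \<in> ball 0 1. f z \<in> ball 0 1} in
      {z. periodic_point f U z} = {z. periodic_point f \<real> z} \<and>
      {z. periodic_point f U z} \<subseteq> \<rat> \<and>
      (\<forall>z n. periodic_point f U z \<and> exact_period f z n \<longrightarrow> multiplier f z n \<in> \<rat>) \<and>
      escaping_quadratic_like f U (ball 0 1) \<and>
      \<not> conj_affine_eql f U (ball 0 1))"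
proof -
  \<comment> \<open>Dependent choice strings single steps into an infinite sequence of
    stages.\<close>
  obtain F where F: "\<And>n. stage n (F n)" "\<And>n. stage_succ n (F n) (F (Suc n))"
    using dependent_nat_choice[of stage stage_succ] stage_0 stage_step by metis
  interpret stages "\<lambda>n. fst (F n)" "\<lambda>n. fst (snd (F n))" "\<lambda>n. fst (snd (snd (F n)))"
    "\<lambda>n. snd (snd (snd (F n)))"
    by unfold_locales (use F in simp_all)
  show ?thesis
  proof (rule exI[of _ f], unfold Let_def dom_def[symmetric], intro conjI allI impI)
    show "transcendental_entire f"
      unfolding transcendental_entire_def using holomorphic_f not_polynomial by blast
    show "{z. periodic_point f dom z} = {z. periodic_point f \<real> z}"
      using periodic_point_Reals_iff[OF convex_on_f] by blast
    show "{z. periodic_point f dom z} \<subseteq> \<rat>"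
      using cyc_rational by (force simp: periodic_point_dom_iff)
    \<comment> \<open>Derivatives of all iterates are rational at cycle points, so the exact period
      does not have to be compared with the period that witnesses periodicity.\<close>
    show "multiplier f z n \<in> \<rat>" if "periodic_point f dom z \<and> exact_period f z n" for z n
      using cyc_multiplier_rational that by (auto simp: periodic_point_dom_iff multiplier_def)
  qed (auto simp: holomorphic_f real_map_def even_map_def real even convex_on_f f_Rats
      escaping_quadratic_like_dom not_conj_affine_dom)
qed

end
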